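(* Let $\mathscr H=\mathbb C^3\otimes\mathbb C^3$, let $Y=P_{\mathscr H}(N\mathbb Z_{/3})$, let $X\subset\mathrm{tr}_2(Y)$ be the simplicial subset of its 2-truncation given by $X_0=Y_0$, $X_1=Y_1$, $X_2=\{\{\Pi^{ab}\}_{a,b\in\mathbb Z_{/3}}\in Y_2\mid \Pi^{11}=\Pi^{21}=\Pi^{12}=0\}$, and let $Z=F_2^Y(X)$ be the full simplicial subset of $Y$ on $X$, with the cyclic structure inherited from $Y$. Then: (1) $Z$ is a simplicial effect. (2) $Z$ is not an effect algebroid.
   Context: Cyclic sets. A cyclic set is a simplicial set $X$ with maps $\tau_n:X_n\to X_n$ ($\tau_0=\mathrm{id}$) satisfying $\tau_n^{n+1}=\mathrm{id}$; $d_i\tau_n=\tau_{n-1}d_{i-1}$ for $1\le i\le n$; $d_0\tau_n=d_n$; $s_i\tau_n=\tau_{n+1}s_{i-1}$ for $1\le i\le n$; $s_0\tau_n=\tau_{n+1}^2s_n$. The cyclic set $Y$. $Y_n$ is the set of families $\Pi=\{\Pi^{a_1\dots a_n}\}_{(a_1,\dots,a_n)\in(\mathbb Z_{/3})^n}$ of orthogonal projectors on $\mathscr H$ with $\sum\Pi^{a_1\dots a_n}=\mathbb 1$. Any structure map $\theta^*$ of the nerve $N(\mathbb Z_{/3})$ acts on $Y$ by summing over fibres, $(\theta^*\Pi)^{y}=\sum_{x:\theta^*x=y}\Pi^{x}$. Here $N(\mathbb Z_{/3})_n=(\mathbb Z_{/3})^n$ has the usual simplicial structure ($d_0,d_n$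 drop the first/last entry, $d_i$ adds the $i$-th and $(i+1)$-st entries, $s_i$ inserts $0$) and the cyclic structure determined by the central element $1\in\mathbb Z_{/3}$: $\tau_n(k_1,\dots,k_n)=(1-k_1-\cdots-k_n,k_1,\dots,k_{n-1})$. For $X\subset\mathrm{tr}_2(Y)$ (the restriction of $Y$ to $\Delta_{\le2}^{\mathrm{op}}$), $F_2^Y(X)\subset Y$ consists of those $n$-simplices $\sigma:\Delta^n\to Y$ such that $\mathrm{tr}_2(\sigma)$ factors through $X$. Conditions (on the underlying simplicial set $X$). Spiny: for $n\ge2$ the map $X_n\to X_1\times_{X_0}\cdots\times_{X_0}X_1$ given by restriction to the spine $\mathrm{Sp}^n\subset\Delta^n$ (union of edges $\{i,i+1\}$) is injective. Inverseless: the square with maps $s_0s_0:X_0\to X_2$, $\mathrm{id}:X_0\to X_0$, $d_1:X_2\to X_1$, $s_0:X_0\to X_1$ is a pullback. For $n\ge3$ and a triangulation $\mathscr T$ (no new vertices) of the convex $(n+1)$-gon with vertices labelled cyclically $0,\dots,n$, let $\Delta^{\mathscr T}\subset\Delta^n$ be generated by the 2-simplices $\Delta^{\{i,j,k\}}$, $\{i,j,k\}$ a triangle of $\mathscr T$. 2-Segal: $X_n\to\mathrm{Hom}(\Delta^{\mathscr T},X)$ is bijective for all $n\ge3$ and all $\mathscr T$. Weakly 2-Segal: for all $n\ge3$, $X_n\to\lim_S\mathrm{Hom}(S,X)$ is bijective, where $S$ runs over the poset (under inclusion) consisting of $\mathrm{Sp}^n$ and all $\Delta^{\mathscr T}$.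 A simplicial effect is a spiny, inverseless, weakly 2-Segal cyclic set. Effect algebroids (multi-object generalizations of effect algebras) are regarded as cyclic sets via Roumen's fully faithful functor $C:\mathsf{EffAlgd}\to\mathsf{Set}_\Lambda$; by Roumen's theorem its essential image consists exactly of the cyclic sets $X$ that are 2-Segal, inverseless, and for which $(d_2,d_0):X_2\to X_1\times_{X_0}X_1$ is injective. "$Z$ is not an effect algebroid" means $Z$ does not lie in this essential image. *)

theory Defs
  imports "HOL-Analysis.Analysis"
begin

section \<open>Simplicial and cyclic sets\<close>

text \<open>A monotone map \<open>\<theta> : [m] \<rightarrow> [n]\<close> is encoded as the list of its values
  \<open>\<theta> 0, \<dots>, \<theta> m\<close>; so \<open>mono_maps m n\<close> is also the set of \<open>m\<close>-simplices of the
  standard simplex \<open>\<Delta>\<^sup>n\<close>.\<close>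

definition mono_maps :: "nat \<Rightarrow> nat \<Rightarrow> nat list set" where
  "mono_maps m n = {\<theta>. length \<theta> = Suc m \<and> sorted \<theta> \<and> set \<theta> \<subseteq> {..n}}"

definition mcomp :: "nat list \<Rightarrow> nat list \<Rightarrow> nat list" where
  "mcomp \<theta> \<phi> = map (\<lambda>i. \<theta> ! i) \<phi>"

definition coface :: "nat \<Rightarrow> nat \<Rightarrow> nat list" where
  "coface n i = [0..<i] @ [Suc i..<Suc n]"

definition codegeneracy :: "nat \<Rightarrow> nat \<Rightarrow> nat list" where
  "codegeneracy n i = [0..<Suc i] @ [i..<Suc n]"

text \<open>\<open>act X n \<theta> : X\<^sub>n \<rightarrow> X\<^sub>m\<close> is the structure map \<open>\<theta>\<^sup>*\<close> for \<open>\<theta> : [m] \<rightarrow> [n]\<close>.\<close>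

record 'a sset =
  simplices :: "nat \<Rightarrow> 'a set"
  act :: "nat \<Rightarrow> nat list \<Rightarrow> 'a \<Rightarrow> 'a"

record 'a cset = "'a sset" +
  rot :: "nat \<Rightarrow> 'a \<Rightarrow> 'a"

definition face :: "('a, 'b) sset_scheme \<Rightarrow> nat \<Rightarrow> nat \<Rightarrow> 'a \<Rightarrow> 'a" where
  "face X n i = act X n (coface n i)"

definition degen :: "('a, 'b) sset_scheme \<Rightarrow> nat \<Rightarrow> nat \<Rightarrow> 'a \<Rightarrow> 'a" where
  "degen X n i = act X n (codegeneracy n i)"

locale simplicial_set =
  fixes X :: "('a, 'b) sset_scheme"
  assumes act_closed: "\<And>m n \<theta> x. \<lbrakk>\<theta> \<in> mono_maps m n; x \<in> simplices X n\<rbrakk>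
      \<Longrightarrow> act X n \<theta> x \<in> simplices X m"
    and act_id: "\<And>n x. x \<in> simplices X n \<Longrightarrow> act X n [0..<Suc n] x = x"
    and act_comp: "\<And>k m n \<theta> \<phi> x.
      \<lbrakk>\<phi> \<in> mono_maps k m; \<theta> \<in> mono_maps m n; x \<in> simplices X n\<rbrakk>
      \<Longrightarrow> act X n (mcomp \<theta> \<phi>) x = act X m \<phi> (act X n \<theta> x)"

locale cyclic_set = simplicial_set X for X :: "('a, 'b) cset_scheme" +
  assumes rot_closed: "\<And>n x. x \<in> simplices X n \<Longrightarrow> rot X n x \<in> simplices X n"
    and rot_0: "\<And>x. x \<in> simplices X 0 \<Longrightarrow> rot X 0 x = x"
    and rot_order: "\<And>n x. x \<in> simplices X n \<Longrightarrow> (rot X n ^^ Suc n) x = x"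
    and face_rot: "\<And>n i x. \<lbrakk>1 \<le> i; i \<le> n; x \<in> simplices X n\<rbrakk>
      \<Longrightarrow> face X n i (rot X n x) = rot X (n - 1) (face X n (i - 1) x)"
    and face_0_rot: "\<And>n x. \<lbrakk>1 \<le> n; x \<in> simplices X n\<rbrakk>
      \<Longrightarrow> face X n 0 (rot X n x) = face X n n x"
    and degen_rot: "\<And>n i x. \<lbrakk>1 \<le> i; i \<le> n; x \<in> simplices X n\<rbrakk>
      \<Longrightarrow> degen X n i (rot X n x) = rot X (Suc n) (degen X n (i - 1) x)"
    and degen_0_rot: "\<And>n x. x \<in> simplices X n
      \<Longrightarrow> degen X n 0 (rot X n x) = rot X (Suc n) (rot X (Suc n) (degen X n n x))"


section \<open>Subcomplexes of the standard simplex and maps out of them\<close>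

text \<open>The simplicial subset of \<open>\<Delta>\<^sup>n\<close> generated by the faces \<open>\<Delta>\<^sup>A\<close>, \<open>A \<in> F\<close>.\<close>

definition subcomplex :: "nat \<Rightarrow> nat set set \<Rightarrow> nat \<Rightarrow> nat list set" where
  "subcomplex n F = (\<lambda>m. {\<theta> \<in> mono_maps m n. \<exists>A\<in>F. set \<theta> \<subseteq> A})"

definition spine :: "nat \<Rightarrow> nat \<Rightarrow> nat list set" where
  "spine n = subcomplex n {{i, Suc i} |i. i < n}"

text \<open>A triangulation of the convex polygon with cyclically ordered vertices \<open>0, \<dots>, n\<close>
  and without new vertices is given by its diagonals: a maximal set of pairwise
  non-crossing diagonals. Edges are pairs \<open>(i, j)\<close> with \<open>i < j\<close>.\<close>

definition polygon_sides :: "nat \<Rightarrow> (nat \<times> nat) set" where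
  "polygon_sides n = {(i, Suc i) |i. i < n} \<union> {(0, n)}"

definition polygon_diagonals :: "nat \<Rightarrow> (nat \<times> nat) set" where
  "polygon_diagonals n = {(i, j). i < j \<and> j \<le> n} - polygon_sides n"

definition crossing :: "nat \<times> nat \<Rightarrow> nat \<times> nat \<Rightarrow> bool" where
  "crossing e f \<longleftrightarrow>
     fst e < fst f \<and> fst f < snd e \<and> snd e < snd f \<or>
     fst f < fst e \<and> fst e < snd f \<and> snd f < snd e"

definition triangulation :: "nat \<Rightarrow> (nat \<times> nat) set \<Rightarrow> bool" where
  "triangulation n T \<longleftrightarrow>
     T \<subseteq> polygon_diagonals n \<and>
     (\<forall>e\<in>T. \<forall>f\<in>T. \<not> crossing e f) \<and>
     (\<forall>e \<in> polygon_diagonals n - T. \<exists>f\<in>T. crossing e f)"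

definition triangles :: "nat \<Rightarrow> (nat \<times> nat) set \<Rightarrow> nat set set" where
  "triangles n T = {{i, j, k} |i j k. i < j \<and> j < k \<and> k \<le> n \<and>
     {(i, j), (j, k), (i, k)} \<subseteq> T \<union> polygon_sides n}"

definition triangulated :: "nat \<Rightarrow> (nat \<times> nat) set \<Rightarrow> nat \<Rightarrow> nat list set" where
  "triangulated n T = subcomplex n (triangles n T)"

text \<open>Simplicial maps \<open>S \<rightarrow> X\<close>, for \<open>S\<close> a simplicial subset of some \<open>\<Delta>\<^sup>n\<close>. They are
  extensional functions, so that equality of maps is equality on \<open>S\<close>.\<close>

definition shom :: "(nat \<Rightarrow> nat list set) \<Rightarrow> ('a, 'b) sset_scheme
    \<Rightarrow> (nat \<Rightarrow> nat list \<Rightarrow> 'a) set" where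
  "shom S X = {f. (\<forall>m. f m \<in> S m \<rightarrow>\<^sub>E simplices X m) \<and>
     (\<forall>k m. \<forall>\<theta> \<in> S m. \<forall>\<phi> \<in> mono_maps k m. f k (mcomp \<theta> \<phi>) = act X m \<phi> (f m \<theta>))}"

definition restrict_to :: "(nat \<Rightarrow> nat list set) \<Rightarrow> (nat \<Rightarrow> nat list \<Rightarrow> 'a)
    \<Rightarrow> nat \<Rightarrow> nat list \<Rightarrow> 'a" where
  "restrict_to S f = (\<lambda>m. restrict (f m) (S m))"

text \<open>The map \<open>S \<subseteq> \<Delta>\<^sup>n \<rightarrow> X\<close> classified by an \<open>n\<close>-simplex \<open>x\<close>.\<close>

definition classified :: "('a, 'b) sset_scheme \<Rightarrow> nat \<Rightarrow> (nat \<Rightarrow> nat list set)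
    \<Rightarrow> 'a \<Rightarrow> nat \<Rightarrow> nat list \<Rightarrow> 'a" where
  "classified X n S x = restrict_to S (\<lambda>m \<theta>. act X n \<theta> x)"


section \<open>Conditions on simplicial sets\<close>

definition spiny :: "('a, 'b) sset_scheme \<Rightarrow> bool" where
  "spiny X \<longleftrightarrow>
     (\<forall>n\<ge>2. inj_on (\<lambda>x. map (\<lambda>i. act X n [i, Suc i] x) [0..<n]) (simplices X n))"

text \<open>The pullback is taken in its standard form as a set of pairs.\<close>

definition inverseless :: "('a, 'b) sset_scheme \<Rightarrow> bool" where
  "inverseless X \<longleftrightarrow>
     bij_betw (\<lambda>x. (degen X 1 0 (degen X 0 0 x), x)) (simplices X 0)
       {(\<sigma>, x). \<sigma> \<in> simplices X 2 \<and> x \<in> simplices X 0 \<and> face X 2 1 \<sigma> = degen X 0 0 x}"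

definition two_Segal :: "('a, 'b) sset_scheme \<Rightarrow> bool" where
  "two_Segal X \<longleftrightarrow> (\<forall>n\<ge>3. \<forall>T. triangulation n T \<longrightarrow>
     bij_betw (classified X n (triangulated n T)) (simplices X n) (shom (triangulated n T) X))"

definition segal_poset :: "nat \<Rightarrow> (nat \<Rightarrow> nat list set) set" where
  "segal_poset n = insert (spine n) {triangulated n T |T. triangulation n T}"

text \<open>The limit of \<open>Hom(S, X)\<close> over a set of subcomplexes ordered by (degreewise) inclusion.\<close>

definition lim_shom :: "(nat \<Rightarrow> nat list set) set \<Rightarrow> ('a, 'b) sset_scheme
    \<Rightarrow> ((nat \<Rightarrow> nat list set) \<Rightarrow> nat \<Rightarrow> nat list \<Rightarrow> 'a) set" where
  "lim_shom P X = {g \<in> (\<Pi>\<^sub>E S\<in>P. shom S X).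
     \<forall>S\<in>P. \<forall>S'\<in>P. S \<le> S' \<longrightarrow> g S = restrict_to S (g S')}"

definition weakly_two_Segal :: "('a, 'b) sset_scheme \<Rightarrow> bool" where
  "weakly_two_Segal X \<longleftrightarrow> (\<forall>n\<ge>3.
     bij_betw (\<lambda>x. \<lambda>S\<in>segal_poset n. classified X n S x)
       (simplices X n) (lim_shom (segal_poset n) X))"

definition simplicial_effect :: "('a, 'b) cset_scheme \<Rightarrow> bool" where
  "simplicial_effect X \<longleftrightarrow> cyclic_set X \<and> spiny X \<and> inverseless X \<and> weakly_two_Segal X"

text \<open>Effect algebroids are regarded as cyclic sets via Roumen's fully faithful functor;
  the predicate describes its essential image, as determined by Roumen's theorem.\<close>

definition effect_algebroid :: "('a, 'b) cset_scheme \<Rightarrow> bool" where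
  "effect_algebroid X \<longleftrightarrow> cyclic_set X \<and> two_Segal X \<and> inverseless X \<and>
     inj_on (\<lambda>\<sigma>. (face X 2 2 \<sigma>, face X 2 0 \<sigma>)) (simplices X 2)"


section \<open>Projective measurements on the nerve of \<open>\<int>/3\<close>\<close>

text \<open>The numeral type \<open>3\<close> is the ring \<open>\<int>/3\<close>; the tuple \<open>(k\<^sub>1, \<dots>, k\<^sub>n)\<close> is a list, so
  \<open>k\<^sub>i\<close> is \<open>k ! (i - 1)\<close>. For \<open>\<theta> : [m] \<rightarrow> [n]\<close>, the \<open>j\<close>-th entry of \<open>\<theta>\<^sup>* k\<close> is the sum of
  the \<open>k\<^sub>i\<close> with \<open>\<theta> (j - 1) < i \<le> \<theta> j\<close>; the lemmas below give the faces and degeneracies.\<close>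

definition nerve_Z3 :: "3 list cset" where
  "nerve_Z3 = \<lparr>
     simplices = (\<lambda>n. {k. length k = n}),
     act = (\<lambda>n \<theta> k. map (\<lambda>j. \<Sum>i = \<theta> ! j..<\<theta> ! Suc j. k ! i) [0..<length \<theta> - 1]),
     rot = (\<lambda>n k. if n = 0 then k else (1 - sum_list k) # butlast k)\<rparr>"

lemma nerve_Z3_face_0: "face nerve_Z3 (Suc (length v)) 0 (a # v) = v"
  by (auto simp: face_def nerve_Z3_def coface_def intro!: nth_equalityI simp del: upt_Suc)

lemma nerve_Z3_face_last: "face nerve_Z3 (Suc (length u)) (Suc (length u)) (u @ [a]) = u"
  by (auto simp: face_def nerve_Z3_def coface_def nth_append intro!: nth_equalityI simp del: upt_Suc)

lemma nerve_Z3_face_inner: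
  "face nerve_Z3 (length u + length v + 2) (Suc (length u)) (u @ a # b # v) = u @ (a + b) # v"
proof -
  let ?n = "Suc (Suc (length u + length v))"
  have c: "coface ?n (Suc (length u)) ! j = (if j \<le> length u then j else Suc j)" if "j < ?n" for j
    using that by (auto simp: coface_def nth_append simp del: upt_Suc)
  have l: "length (coface ?n (Suc (length u))) = ?n"
    by (auto simp: coface_def simp del: upt_Suc)
  show ?thesis
    unfolding face_def nerve_Z3_def
    by (rule nth_equalityI) (auto simp: l c nth_append nth_Cons' not_less le_Suc_eq simp del: upt_Suc)
qed

lemma nerve_Z3_degen:
  "degen nerve_Z3 (length u + length v) (length u) (u @ v) = u @ 0 # v"
proof -
  let ?n = "length u + length v"
  have c: "codegeneracy ?n (length u) ! j = (if j \<le> length u then j else j - 1)"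
    if "j < Suc (Suc ?n)" for j
    using that by (auto simp: codegeneracy_def nth_append simp del: upt_Suc)
  have l: "length (codegeneracy ?n (length u)) = Suc (Suc ?n)"
    by (simp add: codegeneracy_def del: upt_Suc)
  have one: "(\<Sum>i = j - Suc 0..<j. (u @ v) ! i) = v ! (j - Suc (length u))"
    if "length u \<le> j" "j \<noteq> length u" for j
    using that by (cases j) (auto simp: nth_append)
  show ?thesis
    unfolding degen_def nerve_Z3_def
    by (rule nth_equalityI) (auto simp: l c one[unfolded nth_append] nth_append nth_Cons' not_less simp del: upt_Suc)
qed

definition adjoint_mat :: "complex ^ 'h ^ 'h \<Rightarrow> complex ^ 'h ^ 'h" where
  "adjoint_mat A = map_matrix cnj (transpose A)"

definition orth_projector :: "complex ^ 'h ^ 'h \<Rightarrow> bool" where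
  "orth_projector A \<longleftrightarrow> A ** A = A \<and> adjoint_mat A = A"

text \<open>\<open>P\<^sub>\<H>(N)\<close> for \<open>\<H> = \<complex>\<^sup>h\<close> and a cyclic set \<open>N\<close> with finitely many simplices in each
  degree. Families are extended by \<open>0\<close> outside \<open>N\<^sub>n\<close>, so that equality of families is
  equality on \<open>N\<^sub>n\<close>. The index type \<open>3 \<times> 3\<close> gives \<open>\<H> = \<complex>\<^sup>3 \<otimes> \<complex>\<^sup>3\<close> in the basis
  \<open>e\<^sub>i \<otimes> e\<^sub>j\<close>.\<close>

definition projective_measurements ::
    "'i cset \<Rightarrow> ('i \<Rightarrow> complex ^ 'h ^ 'h) cset" where
  "projective_measurements N = \<lparr>
     simplices = (\<lambda>n. {P. (\<forall>x \<in> simplices N n. orth_projector (P x)) \<and>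
        (\<forall>x. x \<notin> simplices N n \<longrightarrow> P x = 0) \<and> (\<Sum>x \<in> simplices N n. P x) = mat 1}),
     act = (\<lambda>n \<theta> P y. \<Sum>x | x \<in> simplices N n \<and> act N n \<theta> x = y. P x),
     rot = (\<lambda>n P y. \<Sum>x | x \<in> simplices N n \<and> rot N n x = y. P x)\<rparr>"

text \<open>\<open>F\<^sub>2\<^sup>Y(X)\<close> for \<open>X \<subseteq> tr\<^sub>2(Y)\<close>: the \<open>n\<close>-simplices of \<open>Y\<close>, viewed as maps
  \<open>\<Delta>\<^sup>n \<rightarrow> Y\<close>, that send all simplices of dimension at most 2 into \<open>X\<close>, with the structure
  maps of \<open>Y\<close>. Only \<open>X 0\<close>, \<open>X 1\<close> and \<open>X 2\<close> matter.\<close>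

definition full_on_2_truncation :: "('a, 'b) cset_scheme \<Rightarrow> (nat \<Rightarrow> 'a set) \<Rightarrow> ('a, 'b) cset_scheme"
  where "full_on_2_truncation Y X = Y\<lparr>simplices := \<lambda>n.
     {\<sigma> \<in> simplices Y n. \<forall>m\<le>2. \<forall>\<theta> \<in> mono_maps m n. act Y n \<theta> \<sigma> \<in> X m}\<rparr>"

end

theory Submission
  imports Defs
begin

text \<open>The projectors of a measurement are pairwise orthogonal, so a measurement is determined by
  its marginals along any separating family of functions, and an operator commuting with those
  marginals commutes with the measurement. Hence an \<open>n\<close>-simplex of \<open>Y\<close> amounts to \<open>n\<close> commuting
  measurements valued in \<open>\<int>/3\<close>, its spine, and \<open>Z\<close> consists of the measurements supported on the
  nerve of the effect algebra \<open>{0, 1/2, 1}\<close>, sitting in \<open>N(\<int>/3)\<close> with \<open>1/2\<close> sent to \<open>2\<close>.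

  For the weak 2-Segal condition, the edge measurements of a compatible family are shown to commute
  by induction on the length of an interval: in a group, the measurements \<open>b\<close> and \<open>b + c\<close> determine
  \<open>c\<close>, so what commutes with the first two commutes with the third. A single triangulation does not
  suffice: if the outcomes of \<open>(a, b)\<close> are \<open>(2, 0)\<close> and \<open>(0, 2)\<close>, then \<open>a + b = 2\<close> is certain, hence
  compatible with every \<open>c\<close>, even one that does not commute with \<open>a\<close>.\<close>

section \<open>Projective measurements on finite sets\<close>

text \<open>A point of the limit assigns a map to the spine and to every triangulation, tied
  together only by inclusions. What this gives directly is agreement on the spine; two
  triangulations sharing a diagonal need not yet assign it the same measurement. The induction
  therefore proves two things at once: the edge measurements of an interval have a joint
  measurement, and its total marginal is the value of every triangulation on the diagonal spanning
  that interval. The second clause lets one triangle of a chosen triangulation supply the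
  commutation needed for the next longer interval. The element 2 plays the role of 1/2 because 2 + 2
  = 1 in Z/3, where 1 is the central element that defines the rotation. Membership in
  \<open>Z\<close> is tested on outcomes: a sum of projectors vanishes only if each summand does, so
  an entry of a face being 0 is a condition on the support.\<close>

lemma matrix_add_rdistrib:
  fixes A B :: "'a::semiring_1 ^ 'n ^ 'm"
  shows "(A + B) ** C = A ** C + B ** C"
  by (simp add: matrix_matrix_mult_def vec_eq_iff distrib_right sum.distrib)

lemma matrix_mult_sum_left:
  fixes B :: "'a::semiring_1 ^ 'p ^ 'n"
  shows "(\<Sum>i\<in>S. A i) ** B = (\<Sum>i\<in>S. A i ** B)"
  by (induction S rule: infinite_finite_induct) (auto simp: matrix_add_rdistrib)

lemma matrix_mult_sum_right:
  fixes B :: "'a::semiring_1 ^ 'n ^ 'm"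
  shows "B ** (\<Sum>i\<in>S. A i) = (\<Sum>i\<in>S. B ** A i)"
  by (induction S rule: infinite_finite_induct) (auto simp: matrix_add_ldistrib)

lemma matrix_mult_diff_left:
  fixes A B :: "'a::ring_1 ^ 'n ^ 'm"
  shows "(A - B) ** C = A ** C - B ** C"
  by (simp add: matrix_matrix_mult_def vec_eq_iff left_diff_distrib sum_subtractf)

lemma matrix_mult_diff_right:
  fixes A :: "'a::ring_1 ^ 'n ^ 'm"
  shows "A ** (B - C) = A ** B - A ** C"
  by (simp add: matrix_matrix_mult_def vec_eq_iff right_diff_distrib sum_subtractf)

section \<open>Adjoints, positivity and orthogonal projectors\<close>

lemma adjoint_mat_mult: "adjoint_mat (A ** B) = adjoint_mat B ** adjoint_mat A"
  by (simp add: adjoint_mat_def map_matrix_def matrix_matrix_mult_def transpose_def vec_eq_iff mult.commute)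

lemma adjoint_mat_sum: "adjoint_mat (\<Sum>i\<in>S. A i) = (\<Sum>i\<in>S. adjoint_mat (A i))"
  by (simp add: adjoint_mat_def map_matrix_def transpose_def vec_eq_iff)

lemma adjoint_mat_diff: "adjoint_mat (A - B) = adjoint_mat A - adjoint_mat B"
  by (simp add: adjoint_mat_def map_matrix_def transpose_def vec_eq_iff)

lemma adjoint_mat_one: "adjoint_mat (mat 1) = mat 1"
  by (auto simp: adjoint_mat_def map_matrix_def transpose_def mat_def vec_eq_iff)

lemma adjoint_mult_self_diag:
  "(adjoint_mat A ** A) $ k $ k = of_real (\<Sum>l\<in>UNIV. (cmod (A $ l $ k))\<^sup>2)"
  by (simp add: adjoint_mat_def map_matrix_def matrix_matrix_mult_def transpose_def
      complex_norm_square mult.commute del: of_real_power)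

text \<open>Positivity: each diagonal entry of the sum is a sum of squared moduli of matrix entries,
  so its vanishing kills the corresponding column of every \<open>A i\<close>.\<close>

lemma sum_adjoint_mult_self_eq_0:
  assumes "finite S" and "(\<Sum>i\<in>S. adjoint_mat (A i) ** A i) = 0" and "i \<in> S"
  shows "A i = 0"
proof -
  have "A i $ l $ k = 0" for l k
  proof -
    have "(\<Sum>i\<in>S. adjoint_mat (A i) ** A i) $ k $ k = 0"
      by (simp add: assms(2))
    then have "complex_of_real (\<Sum>i\<in>S. \<Sum>l\<in>UNIV. (cmod (A i $ l $ k))\<^sup>2) = 0"
      by (simp only: sum_component adjoint_mult_self_diag of_real_sum)
    then have "(\<Sum>i\<in>S. \<Sum>l\<in>UNIV. (cmod (A i $ l $ k))\<^sup>2) = 0"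
      by (simp only: of_real_eq_0_iff)
    then have "(\<Sum>l\<in>UNIV. (cmod (A i $ l $ k))\<^sup>2) = 0"
      using assms(1,3) by (simp add: sum_nonneg_eq_0_iff sum_nonneg)
    then show ?thesis
      by (simp add: sum_nonneg_eq_0_iff)
  qed
  then show ?thesis
    by (simp add: vec_eq_iff)
qed

lemma orth_projector_zero [simp]: "orth_projector 0"
  by (simp add: orth_projector_def adjoint_mat_def map_matrix_def transpose_def vec_eq_iff)

lemma orth_projector_compl:
  assumes "orth_projector A"
  shows "orth_projector (mat 1 - A)"
  using assms
  by (simp add: orth_projector_def adjoint_mat_diff adjoint_mat_one
      matrix_mult_diff_left matrix_mult_diff_right)

lemma orth_projector_mult:
  assumes "orth_projector A" "orth_projector B" "A ** B = B ** A"
  shows "orth_projector (A ** B)"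
  using assms unfolding orth_projector_def
  by (metis adjoint_mat_mult matrix_mul_assoc)

text \<open>A projector equals \<open>adjoint_mat (P i) ** P i\<close>, so positivity applies. It
  turns the vanishing of an entry of a face into a condition on the outcomes above it.\<close>

lemma orth_projector_sum_eq_0:
  assumes "finite S" and "\<And>i. i \<in> S \<Longrightarrow> orth_projector (P i)"
    and "(\<Sum>i\<in>S. P i) = 0" and "i \<in> S"
  shows "P i = 0"
proof (rule sum_adjoint_mult_self_eq_0[OF assms(1) _ assms(4)])
  have "adjoint_mat (P i) ** P i = P i" if "i \<in> S" for i
    using assms(2)[OF that] by (simp add: orth_projector_def)
  with assms(3) show "(\<Sum>i\<in>S. adjoint_mat (P i) ** P i) = 0"
    by simp
qed

text \<open>Simplices of measurements over an arbitrary finite index set, so that booleans and pairs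
  can serve as outcomes beside words.\<close>

definition pvm :: "'i set \<Rightarrow> ('i \<Rightarrow> complex ^ 'h ^ 'h) \<Rightarrow> bool" where
  "pvm I P \<longleftrightarrow> finite I \<and> (\<forall>x\<in>I. orth_projector (P x)) \<and> (\<forall>x. x \<notin> I \<longrightarrow> P x = 0) \<and>
     (\<Sum>x\<in>I. P x) = mat 1"

text \<open>Serves structure maps and rotations alike. No codomain is given: an empty fibre has sum
  0, the value required outside the index set.\<close>

definition push :: "'i set \<Rightarrow> ('i \<Rightarrow> 'j) \<Rightarrow> ('i \<Rightarrow> complex ^ 'h ^ 'h) \<Rightarrow> 'j \<Rightarrow> complex ^ 'h ^ 'h" where
  "push I f P y = (\<Sum>x | x \<in> I \<and> f x = y. P x)"

lemma pvm_orth_projector: "pvm I P \<Longrightarrow> orth_projector (P x)"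
  by (cases "x \<in> I") (auto simp: pvm_def)

lemma pvm_outside: "pvm I P \<Longrightarrow> x \<notin> I \<Longrightarrow> P x = 0"
  by (simp add: pvm_def)

lemma pvm_finite: "pvm I P \<Longrightarrow> finite I"
  by (simp add: pvm_def)

lemma pvm_idem: "pvm I P \<Longrightarrow> P x ** P x = P x"
  using pvm_orth_projector[of I P x] by (simp add: orth_projector_def)

lemma pvm_sum_left: "pvm I P \<Longrightarrow> (\<Sum>x\<in>I. P x ** A) = A"
  unfolding pvm_def by (simp flip: matrix_mult_sum_left)

lemma pvm_sum_right: "pvm I P \<Longrightarrow> (\<Sum>x\<in>I. A ** P x) = A"
  unfolding pvm_def by (simp flip: matrix_mult_sum_right)

text \<open>Compressing \<open>\<Sum> P\<^sub>x = 1\<close> by \<open>P\<^sub>y\<close> gives \<open>\<Sum> (P\<^sub>x P\<^sub>y)\<^sup>* (P\<^sub>x P\<^sub>y) = 0\<close>,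
  the sum over \<open>x \<noteq> y\<close>.\<close>

lemma pvm_orthogonal:
  assumes P: "pvm I P" and "x \<noteq> y"
  shows "P x ** P y = 0"
proof (cases "x \<in> I \<and> y \<in> I")
  case True
  have pr: "P z ** P z = P z" "adjoint_mat (P z) = P z" for z
    using pvm_orth_projector[OF P, of z] by (auto simp: orth_projector_def)
  have fin: "finite I"
    using P by (rule pvm_finite)
  have "adjoint_mat (P z ** P y) ** (P z ** P y) = P y ** (P z ** P y)" for z
    by (metis adjoint_mat_mult matrix_mul_assoc pr)
  then have "(\<Sum>z\<in>I. adjoint_mat (P z ** P y) ** (P z ** P y)) = (\<Sum>z\<in>I. P y ** (P z ** P y))"
    by simp
  also have "\<dots> = P y"
    by (simp add: pvm_sum_left[OF P] pr flip: matrix_mult_sum_right)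
  finally have "(\<Sum>z\<in>I. adjoint_mat (P z ** P y) ** (P z ** P y)) = P y" .
  moreover have "(\<Sum>z\<in>I. adjoint_mat (P z ** P y) ** (P z ** P y)) =
      adjoint_mat (P y ** P y) ** (P y ** P y) +
      (\<Sum>z\<in>I - {y}. adjoint_mat (P z ** P y) ** (P z ** P y))"
    using True fin by (intro sum.remove) auto
  ultimately have "(\<Sum>z\<in>I - {y}. adjoint_mat (P z ** P y) ** (P z ** P y)) = 0"
    by (simp add: pr)
  then show ?thesis
    using True fin \<open>x \<noteq> y\<close>
    by (intro sum_adjoint_mult_self_eq_0[where S = "I - {y}" and A = "\<lambda>z. P z ** P y"]) auto
next
  case False
  then show ?thesis
    using P by (auto simp: pvm_def)
qed

lemma push_cong: "(\<And>x. x \<in> I \<Longrightarrow> f x = g x) \<Longrightarrow> push I f P = push I g P"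
  by (rule ext) (auto simp: push_def intro!: sum.cong)

lemma push_push:
  assumes "finite I" "finite J" "f ` I \<subseteq> J"
  shows "push J g (push I f P) = push I (\<lambda>x. g (f x)) P"
proof
  fix y
  have "push J g (push I f P) y = (\<Sum>z\<in>{z \<in> J. g z = y}. sum P {x \<in> {x \<in> I. g (f x) = y}. f x = z})"
    by (auto simp: push_def intro!: sum.cong)
  also have "\<dots> = push I (\<lambda>x. g (f x)) P y"
    unfolding push_def using assms by (intro sum.group) auto
  finally show "push J g (push I f P) y = push I (\<lambda>x. g (f x)) P y" .
qed

lemma push_inj:
  assumes "inj_on f I" "x \<in> I"
  shows "push I f P (f x) = P x"
proof -
  have "{z. z \<in> I \<and> f z = f x} = {x}"
    using assms by (auto dest: inj_onD)
  then show ?thesis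
    by (simp add: push_def)
qed

lemma push_eq_0: "(\<And>x. x \<in> I \<Longrightarrow> f x = y \<Longrightarrow> P x = 0) \<Longrightarrow> push I f P y = 0"
  by (auto simp: push_def intro!: sum.neutral)

lemma push_nonzeroE:
  assumes "push I f P y \<noteq> 0"
  obtains x where "x \<in> I" "f x = y" "P x \<noteq> 0"
proof -
  have "\<exists>x\<in>I. f x = y \<and> P x \<noteq> 0"
  proof (rule ccontr)
    assume "\<not> ?thesis"
    then have "push I f P y = 0"
      by (intro push_eq_0) auto
    with assms show False ..
  qed
  then show ?thesis
    using that by auto
qed

lemma push_id:
  assumes "\<And>x. x \<notin> I \<Longrightarrow> P x = 0" and "\<And>x. x \<in> I \<Longrightarrow> f x = x"
  shows "push I f P = P"
proof
  fix y
  have "{x. x \<in> I \<and> f x = y} = (if y \<in> I then {y} else {})"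
    using assms(2) by auto
  then show "push I f P y = P y"
    using assms(1) by (simp add: push_def)
qed

text \<open>The outcome \<open>x\<close> lies in one fibre of \<open>f\<close> and is orthogonal to
  all other outcomes; so on the range of \<open>P x\<close> the marginal detects the value of
  \<open>f\<close> at \<open>x\<close>.\<close>

lemma pvm_mult_push:
  assumes "pvm I P" "x \<in> I"
  shows "P x ** push I f P a = (if f x = a then P x else 0)"
proof -
  have "P x ** push I f P a = (\<Sum>z | z \<in> I \<and> f z = a. if x = z then P x else 0)"
    unfolding push_def matrix_mult_sum_right
    using assms by (intro sum.cong) (auto simp: pvm_orthogonal pvm_idem)
  also have "\<dots> = (if f x = a then P x else 0)"
    using assms by (auto simp: sum.delta pvm_def)
  finally show ?thesis .
qed

lemma pvm_push_mult:
  assumes "pvm I P" "x \<in> I"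
  shows "push I f P a ** P x = (if f x = a then P x else 0)"
proof -
  have "push I f P a ** P x = (\<Sum>z | z \<in> I \<and> f z = a. if x = z then P x else 0)"
    unfolding push_def matrix_mult_sum_left
    using assms by (intro sum.cong) (auto simp: pvm_orthogonal pvm_idem)
  also have "\<dots> = (if f x = a then P x else 0)"
    using assms by (auto simp: sum.delta pvm_def)
  finally show ?thesis .
qed

text \<open>Orthogonality leaves only the diagonal terms. The right side is symmetric in the two
  marginals, whence they commute; for \<open>f = g\<close> and \<open>a = b\<close> it gives
  idempotence.\<close>

lemma push_mult_push:
  assumes "pvm I P"
  shows "push I f P a ** push I g P b = (\<Sum>x | x \<in> I \<and> f x = a \<and> g x = b. P x)"
proof -
  have "push I f P a ** push I g P b = (\<Sum>x | x \<in> I \<and> f x = a. if g x = b then P x else 0)"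
    by (subst (1) push_def) (auto simp: matrix_mult_sum_left pvm_mult_push[OF assms] intro!: sum.cong)
  also have "\<dots> = (\<Sum>x | x \<in> I \<and> f x = a \<and> g x = b. P x)"
    using pvm_finite[OF assms] by (simp flip: sum.inter_filter add: conj_assoc)
  finally show ?thesis .
qed

lemma push_commute:
  assumes "pvm I P"
  shows "push I f P a ** push I g P b = push I g P b ** push I f P a"
  unfolding push_mult_push[OF assms] by (metis (no_types, lifting))

lemma pvm_push:
  assumes P: "pvm I P" and "finite J" and "f ` I \<subseteq> J"
  shows "pvm J (push I f P)"
  unfolding pvm_def
proof (intro conjI ballI allI impI)
  show "orth_projector (push I f P y)" for y
    unfolding orth_projector_def
  proof
    show "push I f P y ** push I f P y = push I f P y"
      unfolding push_mult_push[OF P] by (simp add: push_def)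
    show "adjoint_mat (push I f P y) = push I f P y"
      using pvm_orth_projector[OF P] by (simp add: push_def adjoint_mat_sum orth_projector_def)
  qed
  show "push I f P y = 0" if "y \<notin> J" for y
    using that assms(3) by (intro push_eq_0) auto
  show "(\<Sum>y\<in>J. push I f P y) = mat 1"
    using assms by (simp add: push_def sum.group pvm_def)
qed (fact assms)

text \<open>Two measurements with the same marginals along a separating family agree, because
  \<open>P\<^sub>x Q\<^sub>y = 0\<close> for \<open>x \<noteq> y\<close>; hence \<open>P\<^sub>x = P\<^sub>x Q\<^sub>x = Q\<^sub>x\<close>.\<close>

lemma pvm_eqI:
  assumes P: "pvm I P" and Q: "pvm I Q"
    and sep: "\<And>x y. x \<in> I \<Longrightarrow> y \<in> I \<Longrightarrow> (\<And>s. s \<in> S \<Longrightarrow> f s x = f s y) \<Longrightarrow> x = y"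
    and eq: "\<And>s. s \<in> S \<Longrightarrow> push I (f s) P = push I (f s) Q"
  shows "P = Q"
proof
  fix x
  have orth: "P x ** Q y = 0" if "x \<in> I" "y \<in> I" "x \<noteq> y" for x y
  proof -
    obtain s where s: "s \<in> S" "f s x \<noteq> f s y"
      using sep \<open>x \<in> I\<close> \<open>y \<in> I\<close> \<open>x \<noteq> y\<close> by blast
    have "P x ** Q y = P x ** push I (f s) P (f s x) ** Q y"
      by (simp add: pvm_mult_push[OF P \<open>x \<in> I\<close>])
    also have "\<dots> = P x ** (push I (f s) Q (f s x) ** Q y)"
      by (simp add: eq[OF \<open>s \<in> S\<close>] matrix_mul_assoc)
    also have "\<dots> = 0"
      using s by (simp add: pvm_push_mult[OF Q \<open>y \<in> I\<close>])
    finally show ?thesis .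
  qed
  show "P x = Q x"
  proof (cases "x \<in> I")
    case True
    have "P x = (\<Sum>y\<in>I. P x ** Q y)"
      by (simp add: pvm_sum_right[OF Q])
    also have "\<dots> = P x ** Q x"
      using True pvm_finite[OF P] orth by (subst sum.remove[of _ x]) (auto intro!: sum.neutral)
    also have "\<dots> = (\<Sum>y\<in>I. P y ** Q x)"
      using True pvm_finite[OF P] orth by (subst sum.remove[of _ x]) (auto intro!: sum.neutral)
    also have "\<dots> = Q x"
      by (simp add: pvm_sum_left[OF P])
    finally show ?thesis .
  qed (use P Q in \<open>simp add: pvm_def\<close>)
qed

text \<open>The argument for equality with \<open>C\<close> inserted: a separating marginal passes
  through \<open>C\<close> and forces \<open>P x ** C ** P y = 0\<close> off the diagonal, so
  \<open>C\<close> is block diagonal for the decomposition given by \<open>P\<close>.\<close>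

lemma pvm_commuteI:
  assumes P: "pvm I P"
    and sep: "\<And>x y. x \<in> I \<Longrightarrow> y \<in> I \<Longrightarrow> (\<And>s. s \<in> S \<Longrightarrow> f s x = f s y) \<Longrightarrow> x = y"
    and comm: "\<And>s a. s \<in> S \<Longrightarrow> C ** push I (f s) P a = push I (f s) P a ** C"
  shows "C ** P x = P x ** C"
proof -
  have orth: "P x ** C ** P y = 0" if "x \<in> I" "y \<in> I" "x \<noteq> y" for x y
  proof -
    obtain s where s: "s \<in> S" "f s x \<noteq> f s y"
      using sep \<open>x \<in> I\<close> \<open>y \<in> I\<close> \<open>x \<noteq> y\<close> by blast
    have "P x ** C ** P y = P x ** push I (f s) P (f s x) ** C ** P y"
      by (simp add: pvm_mult_push[OF P \<open>x \<in> I\<close>])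
    also have "\<dots> = P x ** C ** (push I (f s) P (f s x) ** P y)"
      by (metis comm[OF \<open>s \<in> S\<close>] matrix_mul_assoc)
    also have "\<dots> = 0"
      using s by (simp add: pvm_push_mult[OF P \<open>y \<in> I\<close>])
    finally show ?thesis .
  qed
  show ?thesis
  proof (cases "x \<in> I")
    case True
    have "P x ** C = (\<Sum>y\<in>I. P x ** C ** P y)"
      by (simp add: pvm_sum_right[OF P])
    also have "\<dots> = P x ** C ** P x"
      using True pvm_finite[OF P] orth by (subst sum.remove[of _ x]) (auto intro!: sum.neutral)
    also have "\<dots> = (\<Sum>y\<in>I. P y ** (C ** P x))"
      using True pvm_finite[OF P] orth
      by (subst sum.remove[of _ x]) (auto intro!: sum.neutral simp: matrix_mul_assoc)
    also have "\<dots> = C ** P x"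
      by (simp add: pvm_sum_left[OF P])
    finally show ?thesis ..
  qed (use P in \<open>simp add: pvm_def\<close>)
qed

text \<open>Commuting makes the products projectors; summing one factor to the identity recovers the
  other.\<close>

lemma pvm_product:
  assumes P: "pvm I P" and Q: "pvm J Q" and comm: "\<And>x y. P x ** Q y = Q y ** P x"
  shows "pvm (I \<times> J) (\<lambda>(x, y). P x ** Q y)"
    and "push (I \<times> J) fst (\<lambda>(x, y). P x ** Q y) = P"
    and "push (I \<times> J) snd (\<lambda>(x, y). P x ** Q y) = Q"
proof -
  show "pvm (I \<times> J) (\<lambda>(x, y). P x ** Q y)"
    using orth_projector_mult[OF pvm_orth_projector[OF P] pvm_orth_projector[OF Q] comm] P Q
    unfolding pvm_def
    by (auto simp: pvm_sum_right[OF Q] simp flip: sum.cartesian_product)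
  show "push (I \<times> J) fst (\<lambda>(x, y). P x ** Q y) = P"
  proof
    fix a
    have "{z. z \<in> I \<times> J \<and> fst z = a} = (if a \<in> I then {a} else {}) \<times> J"
      by auto
    then show "push (I \<times> J) fst (\<lambda>(x, y). P x ** Q y) a = P a"
      using P by (simp add: push_def pvm_sum_right[OF Q] pvm_def flip: sum.cartesian_product)
  qed
  show "push (I \<times> J) snd (\<lambda>(x, y). P x ** Q y) = Q"
  proof
    fix a
    have "{z. z \<in> I \<times> J \<and> snd z = a} = I \<times> (if a \<in> J then {a} else {})"
      by auto
    then show "push (I \<times> J) snd (\<lambda>(x, y). P x ** Q y) a = Q a"
      using Q by (simp add: push_def pvm_sum_left[OF P] pvm_def flip: sum.cartesian_product)
  qed
qed


section \<open>Cyclic sets of measurements\<close>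

lemma mono_maps_length: "\<theta> \<in> mono_maps m n \<Longrightarrow> length \<theta> = Suc m"
  by (simp add: mono_maps_def)

lemma mono_maps_nth_le: "\<theta> \<in> mono_maps m n \<Longrightarrow> j \<le> m \<Longrightarrow> \<theta> ! j \<le> n"
  by (auto simp: mono_maps_def less_Suc_eq_le dest!: subsetD[OF _ nth_mem])

lemma mono_maps_nth_mono: "\<theta> \<in> mono_maps m n \<Longrightarrow> i \<le> j \<Longrightarrow> j \<le> m \<Longrightarrow> \<theta> ! i \<le> \<theta> ! j"
  by (auto simp: mono_maps_def sorted_iff_nth_mono)

lemma mono_mapsI:
  assumes "length \<theta> = Suc m" "\<And>j. j \<le> m \<Longrightarrow> \<theta> ! j \<le> n"
    and "\<And>i j. i \<le> j \<Longrightarrow> j \<le> m \<Longrightarrow> \<theta> ! i \<le> \<theta> ! j"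
  shows "\<theta> \<in> mono_maps m n"
  using assms by (auto simp: mono_maps_def sorted_iff_nth_mono in_set_conv_nth less_Suc_eq_le)

lemma mono_maps_singleton [simp]: "[i] \<in> mono_maps 0 n \<longleftrightarrow> i \<le> n"
  by (auto simp: mono_maps_def)

lemma mono_maps_pair [simp]: "[i, j] \<in> mono_maps (Suc 0) n \<longleftrightarrow> i \<le> j \<and> j \<le> n"
  by (auto simp: mono_maps_def)

lemma mono_maps_triple [simp]: "[i, j, k] \<in> mono_maps 2 n \<longleftrightarrow> i \<le> j \<and> j \<le> k \<and> k \<le> n"
  by (auto simp: mono_maps_def)

lemma length_mcomp [simp]: "length (mcomp \<theta> \<phi>) = length \<phi>"
  by (simp add: mcomp_def)

lemma nth_mcomp [simp]: "j < length \<phi> \<Longrightarrow> mcomp \<theta> \<phi> ! j = \<theta> ! (\<phi> ! j)"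
  by (simp add: mcomp_def)

lemma mcomp_pair [simp]: "mcomp \<theta> [i, j] = [\<theta> ! i, \<theta> ! j]"
  by (simp add: mcomp_def)

lemma mcomp_mono_maps:
  assumes "\<phi> \<in> mono_maps k m" "\<theta> \<in> mono_maps m n"
  shows "mcomp \<theta> \<phi> \<in> mono_maps k n"
  using assms[THEN mono_maps_nth_le] assms[THEN mono_maps_nth_mono] mono_maps_length[OF assms(1)]
  by (intro mono_mapsI) auto

lemma set_mcomp_subset:
  assumes "\<phi> \<in> mono_maps k m" "\<theta> \<in> mono_maps m n"
  shows "set (mcomp \<theta> \<phi>) \<subseteq> set \<theta>"
  using assms by (auto simp: mcomp_def mono_maps_def intro!: nth_mem)

lemma id_mono_maps: "[0..<Suc n] \<in> mono_maps n n"
  by (intro mono_mapsI) (auto simp del: upt_Suc)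

lemma length_coface: "i \<le> n \<Longrightarrow> length (coface n i) = n"
  by (simp add: coface_def del: upt_Suc)

lemma nth_coface: "i \<le> n \<Longrightarrow> j < n \<Longrightarrow> coface n i ! j = (if j < i then j else Suc j)"
  by (auto simp: coface_def nth_append simp del: upt_Suc)

lemma length_codegeneracy: "i \<le> n \<Longrightarrow> length (codegeneracy n i) = Suc (Suc n)"
  by (simp add: codegeneracy_def del: upt_Suc)

lemma nth_codegeneracy:
  "i \<le> n \<Longrightarrow> j \<le> Suc n \<Longrightarrow> codegeneracy n i ! j = (if j \<le> i then j else j - 1)"
  by (auto simp: codegeneracy_def nth_append simp del: upt_Suc)

lemma coface_mono_maps: "1 \<le> n \<Longrightarrow> i \<le> n \<Longrightarrow> coface n i \<in> mono_maps (n - 1) n"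
  by (intro mono_mapsI) (auto simp: length_coface nth_coface)

lemma codegeneracy_mono_maps: "i \<le> n \<Longrightarrow> codegeneracy n i \<in> mono_maps (Suc n) n"
  by (intro mono_mapsI) (auto simp: length_codegeneracy nth_codegeneracy)

lemma (in simplicial_set) degen_closed:
  "i \<le> n \<Longrightarrow> x \<in> simplices X n \<Longrightarrow> degen X n i x \<in> simplices X (Suc n)"
  unfolding degen_def by (rule act_closed[OF codegeneracy_mono_maps])

text \<open>Partial sums are vertex coordinates: the edge from \<open>i\<close> to \<open>j\<close>
  carries their difference. In them the cyclic identities become arithmetic on indices.\<close>

definition psum :: "3 list \<Rightarrow> nat \<Rightarrow> 3" where
  "psum k i = (\<Sum>j<i. k ! j)"

lemma psum_0 [simp]: "psum k 0 = 0"
  by (simp add: psum_def)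

lemma psum_diff: "i \<le> j \<Longrightarrow> (\<Sum>l = i..<j. k ! l) = psum k j - psum k i"
  unfolding psum_def lessThan_atLeast0 by (subst sum_diff_nat_ivl) auto

lemma psum_eqI:
  assumes "length k = n" "length k' = n" "\<And>j. j \<le> n \<Longrightarrow> psum k j = psum k' j"
  shows "k = k'"
proof (rule nth_equalityI)
  fix j assume "j < length k"
  then have "psum k (Suc j) - psum k j = psum k' (Suc j) - psum k' j"
    using assms by (simp add: Suc_leI)
  then show "k ! j = k' ! j"
    by (simp add: psum_def)
qed (use assms in simp)

lemma simplices_nerve: "k \<in> simplices nerve_Z3 n \<longleftrightarrow> length k = n"
  by (simp add: nerve_Z3_def)

lemma finite_simplices_nerve: "finite (simplices nerve_Z3 n)"
  using finite_lists_length_eq[of "UNIV :: 3 set" n] by (simp add: nerve_Z3_def)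

lemma act_nerve:
  assumes "\<theta> \<in> mono_maps m n"
  shows "act nerve_Z3 n \<theta> k = map (\<lambda>j. psum k (\<theta> ! Suc j) - psum k (\<theta> ! j)) [0..<m]"
  using assms
  by (auto simp: nerve_Z3_def mono_maps_length psum_diff mono_maps_nth_mono intro!: map_cong)

lemma length_act_nerve: "\<theta> \<in> mono_maps m n \<Longrightarrow> length (act nerve_Z3 n \<theta> k) = m"
  by (simp add: act_nerve)

text \<open>By telescoping, \<open>\<theta>\<close> acts by reindexing the vertex coordinates and
  subtracting the one at the first vertex.\<close>

lemma psum_act_nerve:
  assumes "\<theta> \<in> mono_maps m n" "j \<le> m"
  shows "psum (act nerve_Z3 n \<theta> k) j = psum k (\<theta> ! j) - psum k (\<theta> ! 0)"
proof -
  have "psum (act nerve_Z3 n \<theta> k) j = (\<Sum>i<j. psum k (\<theta> ! Suc i) - psum k (\<theta> ! i))"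
    using assms by (simp add: act_nerve psum_def)
  then show ?thesis
    using sum_lessThan_telescope[of "\<lambda>i. psum k (\<theta> ! i)" j] by simp
qed

lemma psum_length: "psum k (length k) = sum_list k"
  by (simp add: psum_def sum_list_sum_nth lessThan_atLeast0)

lemma length_rot_nerve: "length (rot nerve_Z3 (length k) k) = length k"
  by (simp add: nerve_Z3_def)

text \<open>Rotation shifts the coordinates by one vertex and adds the new first entry. Coordinate 0
  is a separate case, as the truncated \<open>j - 1\<close> would give \<open>1 - psum k n\<close>
  there.\<close>

lemma psum_rot_nerve:
  assumes "length k = n" "j \<le> n"
  shows "psum (rot nerve_Z3 n k) j = (if j = 0 then 0 else 1 - psum k n + psum k (j - 1))"
proof (cases j)
  case (Suc i)
  have "psum (rot nerve_Z3 n k) (Suc i) = 1 - sum_list k + (\<Sum>l<i. butlast k ! l)"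
    using assms Suc by (auto simp: nerve_Z3_def psum_def sum.lessThan_Suc_shift simp del: sum.lessThan_Suc)
  also have "(\<Sum>l<i. butlast k ! l) = psum k i"
    unfolding psum_def using assms Suc by (intro sum.cong) (auto simp: nth_butlast)
  finally show ?thesis
    using assms Suc by (simp flip: psum_length)
qed auto

text \<open>An \<open>n\<close>-simplex of the nerve is a cyclic word of length \<open>n + 1\<close> with sum \<open>1\<close>, and
  \<open>rot\<close> rotates that word.\<close>

lemma nerve_rot_order: "(rot nerve_Z3 n ^^ Suc n) k = k" if "length k = n"
proof (cases "n = 0")
  case True
  with that show ?thesis
    by (simp add: nerve_Z3_def)
next
  case False
  define L where "L k = k @ [1 - sum_list k]" for k :: "3 list"
  have step: "rotate1 (L (rot nerve_Z3 n k)) = L k" "length (rot nerve_Z3 n k) = n"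
    if "length k = n" for k
  proof -
    have "k \<noteq> []"
      using that False by auto
    then have "sum_list k = sum_list (butlast k) + last k"
      by (metis append_butlast_last_id sum_list_append sum_list.Cons sum_list.Nil add_0_right)
    then have "L (rot nerve_Z3 n k) = (1 - sum_list k) # butlast k @ [last k]"
      using False by (simp add: L_def nerve_Z3_def)
    then show "rotate1 (L (rot nerve_Z3 n k)) = L k"
      using \<open>k \<noteq> []\<close> by (simp add: L_def)
    show "length (rot nerve_Z3 n k) = n"
      using that length_rot_nerve by metis
  qed
  \<comment> \<open>\<open>rot\<close> moves the last letter of the cyclic word to the front and
    \<open>rotate1\<close> moves it back; after \<open>n + 1\<close> steps the accumulated rotation
    is by the full length.\<close>
  have "(rotate1 ^^ m) (L ((rot nerve_Z3 n ^^ m) k)) = L k \<and> length ((rot nerve_Z3 n ^^ m) k) = n"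
    for m
  proof (induction m)
    case (Suc m)
    then show ?case
      unfolding funpow_Suc_right[of m rotate1] by (simp add: step)
  qed (simp add: that)
  from this[of "Suc n"] have "rotate (Suc n) (L ((rot nerve_Z3 n ^^ Suc n) k)) = L k"
    and len: "length ((rot nerve_Z3 n ^^ Suc n) k) = n"
    by (simp_all only: rotate_def)
  moreover have "rotate (Suc n) xs = xs" if "length xs = Suc n" for xs :: "3 list"
    using rotate_id[of "Suc n" xs] that by simp
  ultimately have "L ((rot nerve_Z3 n ^^ Suc n) k) = L k"
    by (simp add: L_def del: funpow.simps rotate_Suc)
  then show ?thesis
    by (simp add: L_def del: funpow.simps)
qed

lemma cyclic_set_nerve: "cyclic_set nerve_Z3"
proof
  fix n :: nat and x :: "3 list"
  assume x: "x \<in> simplices nerve_Z3 n"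
  show "act nerve_Z3 n [0..<Suc n] x = x"
    using x id_mono_maps[of n]
    by (intro psum_eqI[of _ n]) (auto simp: simplices_nerve length_act_nerve psum_act_nerve simp del: upt_Suc)
  show "rot nerve_Z3 n x \<in> simplices nerve_Z3 n"
    using x length_rot_nerve[of x] by (simp add: simplices_nerve)
  show "(rot nerve_Z3 n ^^ Suc n) x = x"
    using x by (simp add: simplices_nerve nerve_rot_order del: funpow.simps)
next
  fix m n \<theta> and x :: "3 list"
  assume "\<theta> \<in> mono_maps m n" "x \<in> simplices nerve_Z3 n"
  then show "act nerve_Z3 n \<theta> x \<in> simplices nerve_Z3 m"
    by (simp add: simplices_nerve length_act_nerve)
next
  fix k m n \<theta> \<phi> and x :: "3 list"
  assume \<phi>: "\<phi> \<in> mono_maps k m" and \<theta>: "\<theta> \<in> mono_maps m n" and x: "x \<in> simplices nerve_Z3 n"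
  show "act nerve_Z3 n (mcomp \<theta> \<phi>) x = act nerve_Z3 m \<phi> (act nerve_Z3 n \<theta> x)"
    using \<phi> \<theta> mcomp_mono_maps[OF \<phi> \<theta>] mono_maps_length[OF \<phi>]
    by (intro psum_eqI[of _ k]) (auto simp: length_act_nerve psum_act_nerve mono_maps_nth_le)
next
  fix x :: "3 list"
  assume "x \<in> simplices nerve_Z3 0"
  then show "rot nerve_Z3 0 x = x"
    by (simp add: nerve_Z3_def)
next
  fix n i :: nat and x :: "3 list"
  assume i: "1 \<le> i" "i \<le> n" and x: "x \<in> simplices nerve_Z3 n"
  have l: "length x = n" "length (rot nerve_Z3 n x) = n"
    using x length_rot_nerve[of x] by (auto simp: simplices_nerve)
  have cf: "coface n i \<in> mono_maps (n - 1) n" "coface n (i - 1) \<in> mono_maps (n - 1) n"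
    using i coface_mono_maps[of n i] coface_mono_maps[of n "i - 1"] by auto
  have lf: "length (act nerve_Z3 n (coface n (i - 1)) x) = n - 1"
    using cf(2) by (rule length_act_nerve)
  show "face nerve_Z3 n i (rot nerve_Z3 n x) = rot nerve_Z3 (n - 1) (face nerve_Z3 n (i - 1) x)"
    unfolding face_def
  proof (rule psum_eqI)
    \<comment> \<open>The rotated side involves the coordinate at \<open>j - 1\<close> and the total
      at \<open>n - 1\<close>, whence the two instances of \<open>psum_act_nerve\<close>.\<close>
    fix j assume "j \<le> n - 1"
    then show "psum (act nerve_Z3 n (coface n i) (rot nerve_Z3 n x)) j =
        psum (rot nerve_Z3 (n - 1) (act nerve_Z3 n (coface n (i - 1)) x)) j"
      using i psum_act_nerve[OF cf(2), of "j - 1" x]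
        psum_act_nerve[OF cf(2), of "n - 1" x] psum_rot_nerve[OF lf, of j]
      by (auto simp: psum_act_nerve[OF cf(1)] psum_rot_nerve[OF l(1)] nth_coface)
  qed (use lf length_rot_nerve[of "act nerve_Z3 n (coface n (i - 1)) x"] length_act_nerve[OF cf(1)] in auto)
  have cd: "codegeneracy n i \<in> mono_maps (Suc n) n" "codegeneracy n (i - 1) \<in> mono_maps (Suc n) n"
    using i by (auto intro!: codegeneracy_mono_maps)
  have ld: "length (act nerve_Z3 n (codegeneracy n (i - 1)) x) = Suc n"
    using cd(2) by (rule length_act_nerve)
  show "degen nerve_Z3 n i (rot nerve_Z3 n x) = rot nerve_Z3 (Suc n) (degen nerve_Z3 n (i - 1) x)"
    unfolding degen_def
  proof (rule psum_eqI)
    fix j assume "j \<le> Suc n"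
    then show "psum (act nerve_Z3 n (codegeneracy n i) (rot nerve_Z3 n x)) j =
        psum (rot nerve_Z3 (Suc n) (act nerve_Z3 n (codegeneracy n (i - 1)) x)) j"
      using i psum_act_nerve[OF cd(2), of "j - 1" x] psum_act_nerve[OF cd(2), of "Suc n" x]
        psum_rot_nerve[OF ld, of j]
      by (auto simp: psum_act_nerve[OF cd(1)] psum_rot_nerve[OF l(1)] nth_codegeneracy)
  qed (use ld length_rot_nerve[of "act nerve_Z3 n (codegeneracy n (i - 1)) x"] length_act_nerve[OF cd(1)] in auto)
next
  fix n :: nat and x :: "3 list"
  assume n: "1 \<le> n" and x: "x \<in> simplices nerve_Z3 n"
  have l: "length x = n"
    using x by (simp add: simplices_nerve)
  have cf: "coface n 0 \<in> mono_maps (n - 1) n" "coface n n \<in> mono_maps (n - 1) n"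
    using n coface_mono_maps[of n 0] coface_mono_maps[of n n] by auto
  show "face nerve_Z3 n 0 (rot nerve_Z3 n x) = face nerve_Z3 n n x"
    unfolding face_def
    by (rule psum_eqI[of _ "n - 1"])
      (use n l in \<open>auto simp: length_act_nerve[OF cf(1)] length_act_nerve[OF cf(2)]
         psum_act_nerve[OF cf(1)] psum_act_nerve[OF cf(2)] psum_rot_nerve nth_coface\<close>)
next
  fix n :: nat and x :: "3 list"
  assume x: "x \<in> simplices nerve_Z3 n"
  have l: "length x = n"
    using x by (simp add: simplices_nerve)
  have cd: "codegeneracy n 0 \<in> mono_maps (Suc n) n" "codegeneracy n n \<in> mono_maps (Suc n) n"
    by (auto intro!: codegeneracy_mono_maps)
  let ?y = "act nerve_Z3 n (codegeneracy n n) x"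
  have ly: "length ?y = Suc n" "length (rot nerve_Z3 (Suc n) ?y) = Suc n"
    "length (rot nerve_Z3 (Suc n) (rot nerve_Z3 (Suc n) ?y)) = Suc n"
    using length_act_nerve[OF cd(2), of x] length_rot_nerve by metis+
  show "degen nerve_Z3 n 0 (rot nerve_Z3 n x) =
      rot nerve_Z3 (Suc n) (rot nerve_Z3 (Suc n) (degen nerve_Z3 n n x))"
    unfolding degen_def
  proof (rule psum_eqI)
    fix j assume "j \<le> Suc n"
    then show "psum (act nerve_Z3 n (codegeneracy n 0) (rot nerve_Z3 n x)) j =
        psum (rot nerve_Z3 (Suc n) (rot nerve_Z3 (Suc n) ?y)) j"
      using l ly
      by (auto simp: psum_act_nerve[OF cd(1)] psum_act_nerve[OF cd(2)] psum_rot_nerve nth_codegeneracy)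
  qed (use ly length_act_nerve[OF cd(1)] in auto)
qed

section \<open>Measurements on an arbitrary cyclic set\<close>

lemma simplices_projective_measurements:
  assumes "finite (simplices N n)"
  shows "P \<in> simplices (projective_measurements N) n \<longleftrightarrow> pvm (simplices N n) P"
  using assms by (auto simp: projective_measurements_def pvm_def)

lemma act_projective_measurements:
  "act (projective_measurements N) n \<theta> = push (simplices N n) (act N n \<theta>)"
  by (simp add: projective_measurements_def push_def fun_eq_iff)

lemma rot_projective_measurements:
  "rot (projective_measurements N) n = push (simplices N n) (rot N n)"
  by (simp add: projective_measurements_def push_def fun_eq_iff)

text \<open>\<open>push\<close> is functorial, so each identity reduces to the same identity in
  \<open>N\<close>, pointwise on simplices.\<close>

lemma cyclic_set_projective_measurements:
  assumes N: "cyclic_set N" and fin: "\<And>n. finite (simplices N n)"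
  shows "cyclic_set (projective_measurements N :: ('i \<Rightarrow> complex ^ 'h ^ 'h) cset)"
proof -
  interpret N: cyclic_set N
    by (fact N)
  note simps = simplices_projective_measurements[OF fin] act_projective_measurements
    rot_projective_measurements
  have push2: "push (simplices N m) g (push (simplices N n) f P) = push (simplices N n) (\<lambda>x. g (f x)) P"
    if "f ` simplices N n \<subseteq> simplices N m" for m n f and g :: "'i \<Rightarrow> 'i" and P :: "'i \<Rightarrow> complex ^ 'h ^ 'h"
    using push_push[OF fin fin that] .
  have act: "act N n \<theta> ` simplices N n \<subseteq> simplices N m" if "\<theta> \<in> mono_maps m n" for \<theta> m n
    using N.act_closed[OF that] by auto
  have rot: "rot N n ` simplices N n \<subseteq> simplices N n" for n
    using N.rot_closed by auto
  have face: "act N n (coface n i) ` simplices N n \<subseteq> simplices N (n - 1)" if "1 \<le> n" "i \<le> n" for n i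
    using act[OF coface_mono_maps[OF that]] .
  have degen: "act N n (codegeneracy n i) ` simplices N n \<subseteq> simplices N (Suc n)" if "i \<le> n" for n i
    using act[OF codegeneracy_mono_maps[OF that]] .
  \<comment> \<open>The induction starts at the literal identity, which is \<open>push\<close> along
    the identity only for families vanishing outside the simplices; hence the hypothesis on
    \<open>P\<close>.\<close>
  have funpow: "(push (simplices N n) (rot N n) ^^ m) P = push (simplices N n) (rot N n ^^ m) P"
    if "pvm (simplices N n) P" for n m and P :: "'i \<Rightarrow> complex ^ 'h ^ 'h"
  proof (induction m)
    case 0
    show ?case
      using that by (simp add: push_id pvm_outside)
  next
    case (Suc m)
    have "(rot N n ^^ m) ` simplices N n \<subseteq> simplices N n"
      by (induction m) (auto simp: N.rot_closed image_subset_iff)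
    from push2[OF this] show ?case
      by (simp add: Suc o_def)
  qed
  show ?thesis
  proof
    fix m n \<theta> and P :: "'i \<Rightarrow> complex ^ 'h ^ 'h"
    assume "\<theta> \<in> mono_maps m n" "P \<in> simplices (projective_measurements N) n"
    then show "act (projective_measurements N) n \<theta> P \<in> simplices (projective_measurements N) m"
      by (simp add: simps pvm_push fin act)
  next
    fix n and P :: "'i \<Rightarrow> complex ^ 'h ^ 'h"
    assume "P \<in> simplices (projective_measurements N) n"
    then show "act (projective_measurements N) n [0..<Suc n] P = P"
      unfolding simps by (intro push_id) (auto simp: pvm_outside N.act_id simp del: upt_Suc)
  next
    fix k m n \<theta> \<phi> and P :: "'i \<Rightarrow> complex ^ 'h ^ 'h"
    assume \<phi>: "\<phi> \<in> mono_maps k m" and \<theta>: "\<theta> \<in> mono_maps m n"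
    show "act (projective_measurements N) n (mcomp \<theta> \<phi>) P =
        act (projective_measurements N) m \<phi> (act (projective_measurements N) n \<theta> P)"
      unfolding simps push2[OF act[OF \<theta>]] by (intro push_cong) (rule N.act_comp[OF \<phi> \<theta>])
  next
    fix n and P :: "'i \<Rightarrow> complex ^ 'h ^ 'h"
    assume "P \<in> simplices (projective_measurements N) n"
    then show "rot (projective_measurements N) n P \<in> simplices (projective_measurements N) n"
      by (simp add: simps pvm_push fin rot)
  next
    fix P :: "'i \<Rightarrow> complex ^ 'h ^ 'h"
    assume "P \<in> simplices (projective_measurements N) 0"
    then show "rot (projective_measurements N) 0 P = P"
      unfolding simps by (intro push_id) (auto simp: pvm_outside N.rot_0)
  next
    fix n and P :: "'i \<Rightarrow> complex ^ 'h ^ 'h"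
    assume "P \<in> simplices (projective_measurements N) n"
    then show "(rot (projective_measurements N) n ^^ Suc n) P = P"
      unfolding simps by (subst funpow) (auto simp: pvm_outside N.rot_order simp del: funpow.simps intro!: push_id)
  next
    fix n i :: nat and P :: "'i \<Rightarrow> complex ^ 'h ^ 'h"
    assume i: "1 \<le> i" "i \<le> n"
    have *: "1 \<le> n" "i - 1 \<le> n"
      using i by auto
    show "face (projective_measurements N) n i (rot (projective_measurements N) n P) =
        rot (projective_measurements N) (n - 1) (face (projective_measurements N) n (i - 1) P)"
      unfolding simps face_def push2[OF rot] push2[OF face[OF *]]
      using N.face_rot[OF i] by (intro push_cong) (simp add: face_def)
    show "degen (projective_measurements N) n i (rot (projective_measurements N) n P) =
        rot (projective_measurements N) (Suc n) (degen (projective_measurements N) n (i - 1) P)"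
      unfolding simps degen_def push2[OF rot] push2[OF degen[OF *(2)]]
      using N.degen_rot[OF i] by (intro push_cong) (simp add: degen_def)
  next
    fix n :: nat and P :: "'i \<Rightarrow> complex ^ 'h ^ 'h"
    assume n: "1 \<le> n"
    show "face (projective_measurements N) n 0 (rot (projective_measurements N) n P) =
        face (projective_measurements N) n n P"
      unfolding simps face_def push2[OF rot]
      using N.face_0_rot[OF n] by (intro push_cong) (simp add: face_def)
  next
    fix n and P :: "'i \<Rightarrow> complex ^ 'h ^ 'h"
    have "act N n (codegeneracy n n) ` simplices N n \<subseteq> simplices N (Suc n)"
      by (rule degen) simp
    moreover from this have "(\<lambda>x. rot N (Suc n) (act N n (codegeneracy n n) x)) ` simplices N n \<subseteq> simplices N (Suc n)"
      using N.rot_closed by blast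
    ultimately show "degen (projective_measurements N) n 0 (rot (projective_measurements N) n P) =
        rot (projective_measurements N) (Suc n) (rot (projective_measurements N) (Suc n)
          (degen (projective_measurements N) n n P))"
      unfolding simps degen_def push2[OF rot]
      using N.degen_0_rot by (simp add: push2 degen_def cong: push_cong)
  qed
qed

section \<open>Full subobjects on a 2-truncation\<close>

lemma simplices_full:
  "simplices (full_on_2_truncation Y X) n =
     {\<sigma> \<in> simplices Y n. \<forall>m\<le>2. \<forall>\<theta> \<in> mono_maps m n. act Y n \<theta> \<sigma> \<in> X m}"
  and act_full: "act (full_on_2_truncation Y X) = act Y"
  and rot_full: "rot (full_on_2_truncation Y' X') = rot Y'"
  by (simp_all add: full_on_2_truncation_def)

lemma simplicial_set_full:
  assumes "simplicial_set Y"
  shows "simplicial_set (full_on_2_truncation Y X)"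
proof -
  interpret simplicial_set Y
    by (fact assms)
  have "act Y m \<phi> (act Y n \<theta> x) \<in> X k"
    if "\<theta> \<in> mono_maps m n" "\<phi> \<in> mono_maps k m" "x \<in> simplices (full_on_2_truncation Y X) n" "k \<le> 2"
    for k m n \<theta> \<phi> x
    using that act_comp[of \<phi> k m \<theta> n x] mcomp_mono_maps[of \<phi> k m \<theta> n]
    by (auto simp: simplices_full) metis
  then show ?thesis
    by unfold_locales (auto simp: simplices_full act_full act_id act_comp intro: act_closed simp del: upt_Suc)
qed

text \<open>Fullness speaks of monotone maps only, so closure under rotation does not follow from it
  and is assumed; the identities are inherited.\<close>

lemma cyclic_set_full:
  assumes "cyclic_set Y"
    and "\<And>n \<sigma>. \<sigma> \<in> simplices (full_on_2_truncation Y X) n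
      \<Longrightarrow> rot Y n \<sigma> \<in> simplices (full_on_2_truncation Y X) n"
  shows "cyclic_set (full_on_2_truncation Y X)"
proof -
  interpret Y: cyclic_set Y
    by (fact assms)
  interpret Z: simplicial_set "full_on_2_truncation Y X"
    by (rule simplicial_set_full) unfold_locales
  have sub: "\<sigma> \<in> simplices Y n" if "\<sigma> \<in> simplices (full_on_2_truncation Y X) n" for \<sigma> n
    using that by (simp add: simplices_full)
  show ?thesis
    using Y.rot_0 Y.rot_order Y.face_rot Y.face_0_rot Y.degen_rot Y.degen_0_rot
    by unfold_locales
      (auto simp: rot_full act_full face_def degen_def assms(2) dest!: sub simp del: funpow.simps)
qed


section \<open>Triangulations of polygons\<close>

lemma crossing_sym: "crossing e f \<longleftrightarrow> crossing f e"
  by (auto simp: crossing_def)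

lemma finite_polygon_diagonals: "finite (polygon_diagonals n)"
  by (rule finite_subset[of _ "{..n} \<times> {..n}"]) (auto simp: polygon_diagonals_def)

lemma triangulation_diagonal:
  assumes "triangulation n T" "(i, j) \<in> T"
  shows "i < j" "j \<le> n"
proof -
  have "(i, j) \<in> polygon_diagonals n"
    using assms unfolding triangulation_def by (elim conjE) (rule subsetD)
  then show "i < j" "j \<le> n"
    by (simp_all add: polygon_diagonals_def)
qed

lemma triangulation_edge_bounds:
  "triangulation n T \<Longrightarrow> n \<ge> 1 \<Longrightarrow> (i, j) \<in> T \<union> polygon_sides n \<Longrightarrow> i < j \<and> j \<le> n"
  using triangulation_diagonal[of n T i j] by (auto simp: polygon_sides_def)

lemma triangulation_edges_not_crossing:
  assumes "triangulation n T" "e \<in> T" "f \<in> T \<union> polygon_sides n"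
  shows "\<not> crossing e f"
proof (cases "f \<in> T")
  case False
  moreover have "fst e < snd e" "snd e \<le> n"
    using triangulation_diagonal[OF assms(1), of "fst e" "snd e"] assms(2) by simp_all
  ultimately show ?thesis
    using assms(3) by (auto simp: polygon_sides_def crossing_def)
qed (use assms in \<open>simp add: triangulation_def\<close>)

text \<open>Take the longest edge \<open>(i, k)\<close> with \<open>k < j\<close>: a diagonal crossing \<open>(k, j)\<close> would cross
  \<open>(i, j)\<close> or \<open>(i, k)\<close>, or be a longer such edge.\<close>

lemma triangulation_inner_vertex:
  assumes T: "triangulation n T" and ij: "(i, j) \<in> T \<union> polygon_sides n" and "i + 2 \<le> j"
  obtains k where "i < k" "k < j" "(i, k) \<in> T \<union> polygon_sides n" "(k, j) \<in> T \<union> polygon_sides n"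
proof -
  let ?E = "T \<union> polygon_sides n"
  have "n \<ge> 1"
    using triangulation_diagonal[OF T, of i j] ij \<open>i + 2 \<le> j\<close> by (auto simp: polygon_sides_def)
  from triangulation_edge_bounds[OF T this ij] have "j \<le> n"
    by simp
  let ?K = "{k. i < k \<and> k < j \<and> (i, k) \<in> ?E}"
  have "Suc i \<in> ?K"
    using \<open>i + 2 \<le> j\<close> \<open>j \<le> n\<close> by (auto simp: polygon_sides_def)
  moreover have fin: "finite ?K"
    by simp
  ultimately have K: "Max ?K \<in> ?K"
    by (intro Max_in) auto
  define k where "k = Max ?K"
  have k: "i < k" "k < j" "(i, k) \<in> ?E"
    using K by (auto simp: k_def)
  have "(k, j) \<in> ?E"
  proof (rule ccontr)
    assume kj: "(k, j) \<notin> ?E"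
    then have "(k, j) \<in> polygon_diagonals n - T"
      using k \<open>j \<le> n\<close> by (auto simp: polygon_diagonals_def)
    moreover have "\<forall>e \<in> polygon_diagonals n - T. \<exists>f\<in>T. crossing e f"
      using T by (simp add: triangulation_def)
    ultimately obtain f where "f \<in> T" "crossing (k, j) f"
      by blast
    then obtain p q where f: "(p, q) \<in> T" "crossing (k, j) (p, q)"
      by (cases f) simp
    have nc: "\<not> crossing (p, q) (i, j)" "\<not> crossing (p, q) (i, k)"
      using triangulation_edges_not_crossing[OF T f(1)] ij k(3) by simp_all
    have "p = i" "k < q" "q < j"
      using f(2) nc k(1,2) unfolding crossing_def fst_conv snd_conv by linarith+
    then have "q \<in> ?K"
      using k f(1) by auto
    then have "q \<le> k"
      unfolding k_def using fin by (intro Max_ge)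
    with \<open>k < q\<close> show False
      by simp
  qed
  with k show ?thesis
    by (intro that)
qed

lemma trianglesI:
  assumes "i < j" "j < k" "k \<le> n" "(i, j) \<in> T \<union> polygon_sides n"
    "(j, k) \<in> T \<union> polygon_sides n" "(i, k) \<in> T \<union> polygon_sides n"
  shows "{i, j, k} \<in> triangles n T"
  unfolding triangles_def mem_Collect_eq
  by (intro exI conjI, rule refl) (use assms in simp_all)

text \<open>Descent through nested edges: the triangle below \<open>(p, q)\<close> has an apex
  \<open>k\<close>, and the side lies below \<open>(p, k)\<close> or \<open>(k, q)\<close>, until
  one of these is the side itself. This puts the spine inside every triangulation.\<close>

lemma triangulation_side_in_triangle:
  assumes T: "triangulation n T" and "n \<ge> 2" and "i < n"
  shows "\<exists>A\<in>triangles n T. {i, Suc i} \<subseteq> A"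
proof -
  let ?E = "T \<union> polygon_sides n"
  have "\<exists>A\<in>triangles n T. {i, Suc i} \<subseteq> A"
    if "(p, q) \<in> ?E" "p \<le> i" "Suc i \<le> q" "p + 2 \<le> q" for p q
    using that
  proof (induction "q - p" arbitrary: p q rule: less_induct)
    case less
    obtain k where k: "p < k" "k < q" "(p, k) \<in> ?E" "(k, q) \<in> ?E"
      using triangulation_inner_vertex[OF T less.prems(1,4)] .
    have "q \<le> n"
      using triangulation_edge_bounds[OF T _ less.prems(1)] \<open>n \<ge> 2\<close> by simp
    have A: "{p, k, q} \<in> triangles n T"
      using k(1,2) \<open>q \<le> n\<close> k(3,4) less.prems(1) by (rule trianglesI)
    show ?case
    proof (cases "Suc i \<le> k")
      case True
      show ?thesis
      proof (cases "p + 2 \<le> k")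
        case True
        then show ?thesis
          by (intro less.hyps[OF _ k(3) less.prems(2) \<open>Suc i \<le> k\<close>]) (use k in simp_all)
      next
        case False
        then have "p = i" "k = Suc i"
          using k less.prems \<open>Suc i \<le> k\<close> by auto
        then show ?thesis
          by (intro bexI[OF _ A]) auto
      qed
    next
      case False
      show ?thesis
      proof (cases "k + 2 \<le> q")
        case True
        then show ?thesis
          by (intro less.hyps[OF _ k(4) _ less.prems(3)]) (use k \<open>\<not> Suc i \<le> k\<close> in simp_all)
      next
        case False
        then have "k = i" "q = Suc i"
          using k less.prems \<open>\<not> Suc i \<le> k\<close> by auto
        then show ?thesis
          by (intro bexI[OF _ A]) auto
      qed
    qed
  qed
  moreover have "(0, n) \<in> ?E"
    by (simp add: polygon_sides_def)
  ultimately show ?thesis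
    using assms(2,3) by simp
qed

text \<open>There are finitely many diagonals, so some non-crossing superset of \<open>D\<close> is
  maximal, and adding a further diagonal to it creates a crossing.\<close>

lemma triangulation_extends:
  assumes "D \<subseteq> polygon_diagonals n" "\<And>e f. e \<in> D \<Longrightarrow> f \<in> D \<Longrightarrow> \<not> crossing e f"
  obtains T where "triangulation n T" "D \<subseteq> T"
proof -
  define C where "C = {T. D \<subseteq> T \<and> T \<subseteq> polygon_diagonals n \<and> (\<forall>e\<in>T. \<forall>f\<in>T. \<not> crossing e f)}"
  have "finite C"
    by (rule finite_subset[of _ "Pow (polygon_diagonals n)"])
      (auto simp: C_def finite_polygon_diagonals)
  moreover have "D \<in> C"
    using assms by (simp add: C_def)
  ultimately obtain T where T: "T \<in> C" "\<And>U. U \<in> C \<Longrightarrow> T \<subseteq> U \<Longrightarrow> T = U"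
    by (metis finite_has_maximal2)
  have sub: "D \<subseteq> T" "T \<subseteq> polygon_diagonals n" and nc: "\<forall>e\<in>T. \<forall>f\<in>T. \<not> crossing e f"
    using T(1) by (simp_all add: C_def)
  have "\<exists>f\<in>T. crossing e f" if e: "e \<in> polygon_diagonals n - T" for e
  proof (rule ccontr)
    assume not: "\<not> (\<exists>f\<in>T. crossing e f)"
    moreover have "\<not> crossing e e"
      by (simp add: crossing_def)
    moreover have "\<not> crossing f e" if "f \<in> T" for f
      using not that crossing_sym[of f e] by auto
    ultimately have "insert e T \<in> C"
      using sub nc e by (simp add: C_def subset_insertI2)
    then have "T = insert e T"
      by (rule T(2)) auto
    then show False
      using e by auto
  qed
  then have "triangulation n T"
    using sub nc by (simp add: triangulation_def)
  then show ?thesis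
    using sub(1) by (rule that)
qed

text \<open>Edges of one triangle do not cross, so those that are diagonals extend to a
  triangulation; the intersection sets aside those that are sides of the polygon.\<close>

lemma triangle_in_triangulation:
  assumes "i < j" "j < k" "k \<le> n"
  obtains T where "triangulation n T" "{(i, j), (j, k), (i, k)} \<subseteq> T \<union> polygon_sides n"
proof -
  let ?D = "{(i, j), (j, k), (i, k)} \<inter> polygon_diagonals n"
  obtain T where T: "triangulation n T" "?D \<subseteq> T"
    by (rule triangulation_extends[of ?D n]) (use assms in \<open>auto simp: crossing_def\<close>)
  moreover have "{(i, j), (j, k), (i, k)} \<subseteq> polygon_diagonals n \<union> polygon_sides n"
    using assms by (auto simp: polygon_diagonals_def)
  ultimately show ?thesis
    by (intro that[of T]) auto
qed

section \<open>Maps out of subcomplexes of the standard simplex\<close>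

lemma subcomplex_subset: "\<theta> \<in> subcomplex n F m \<Longrightarrow> \<theta> \<in> mono_maps m n"
  by (simp add: subcomplex_def)

lemma mcomp_subcomplex:
  "\<theta> \<in> subcomplex n F m \<Longrightarrow> \<phi> \<in> mono_maps k m \<Longrightarrow> mcomp \<theta> \<phi> \<in> subcomplex n F k"
  using mcomp_mono_maps[of \<phi> k m \<theta> n] set_mcomp_subset[of \<phi> k m \<theta> n]
  by (auto simp: subcomplex_def dest: subset_trans)

lemma subcomplex_mono:
  assumes "\<And>A. A \<in> F \<Longrightarrow> \<exists>B\<in>G. A \<subseteq> B"
  shows "subcomplex n F \<le> subcomplex n G"
proof (rule le_funI, rule subsetI)
  fix m \<theta>
  assume "\<theta> \<in> subcomplex n F m"
  then obtain A where A: "\<theta> \<in> mono_maps m n" "A \<in> F" "set \<theta> \<subseteq> A"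
    by (auto simp: subcomplex_def)
  obtain B where "B \<in> G" "A \<subseteq> B"
    using assms[OF A(2)] by (rule bexE)
  moreover from A(3) this(2) have "set \<theta> \<subseteq> B"
    by (rule subset_trans)
  ultimately show "\<theta> \<in> subcomplex n G m"
    using A(1) unfolding subcomplex_def by simp (rule bexI)
qed

lemma spine_le_triangulated:
  assumes "triangulation n T" "n \<ge> 2"
  shows "spine n \<le> triangulated n T"
  unfolding spine_def triangulated_def
  by (rule subcomplex_mono) (use triangulation_side_in_triangle[OF assms] in auto)

lemma spine_edge: "i < n \<Longrightarrow> [i, Suc i] \<in> spine n (Suc 0)"
  unfolding spine_def subcomplex_def by (simp, rule exI[of _ "{i, Suc i}"]) auto

lemma segal_poset_cases:
  assumes "S \<in> segal_poset n"
  obtains "S = spine n" | T where "triangulation n T" "S = triangulated n T"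
  using assms by (auto simp: segal_poset_def)

lemma segal_poset_subcomplex: "S \<in> segal_poset n \<Longrightarrow> \<exists>F. S = subcomplex n F"
  by (auto simp: segal_poset_def spine_def triangulated_def)

lemma triangulated_edgeD:
  assumes "[i, j] \<in> triangulated n T (Suc 0)" "i < j"
  shows "(i, j) \<in> T \<union> polygon_sides n"
  using assms unfolding triangulated_def subcomplex_def triangles_def by auto

lemma triangulated_triangle:
  assumes "{(i, j), (j, k), (i, k)} \<subseteq> T \<union> polygon_sides n" "i < j" "j < k" "k \<le> n"
  shows "[i, j, k] \<in> triangulated n T 2"
proof -
  have "{i, j, k} \<in> triangles n T"
    by (rule trianglesI) (use assms in auto)
  then have "\<exists>A\<in>triangles n T. set [i, j, k] \<subseteq> A"
    by (rule bexI[rotated]) simp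
  then show ?thesis
    using assms(2-4) by (simp add: triangulated_def subcomplex_def)
qed

lemma shom_closed: "f \<in> shom S X \<Longrightarrow> \<theta> \<in> S m \<Longrightarrow> f m \<theta> \<in> simplices X m"
  by (auto simp: shom_def)

lemma shom_mcomp: "f \<in> shom S X \<Longrightarrow> \<theta> \<in> S m \<Longrightarrow> \<phi> \<in> mono_maps k m \<Longrightarrow>
    f k (mcomp \<theta> \<phi>) = act X m \<phi> (f m \<theta>)"
  by (simp add: shom_def)

lemma classified_apply: "\<theta> \<in> S m \<Longrightarrow> classified X n S x m \<theta> = act X n \<theta> x"
  by (simp add: classified_def restrict_to_def)

lemma restrict_to_classified: "S \<le> S' \<Longrightarrow> restrict_to S (classified X n S' x) = classified X n S x"
  by (auto simp: classified_def restrict_to_def le_fun_def fun_eq_iff restrict_def subset_iff)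

lemma (in simplicial_set) classified_shom:
  assumes "x \<in> simplices X n"
  shows "classified X n (subcomplex n F) x \<in> shom (subcomplex n F) X"
  unfolding shom_def
proof (safe intro!: PiE_I)
  fix m \<theta>
  assume \<theta>: "\<theta> \<in> subcomplex n F m"
  then show "classified X n (subcomplex n F) x m \<theta> \<in> simplices X m"
    by (simp add: classified_apply act_closed[OF subcomplex_subset[OF \<theta>] assms])
  fix k \<phi>
  assume \<phi>: "\<phi> \<in> mono_maps k m"
  show "classified X n (subcomplex n F) x k (mcomp \<theta> \<phi>) =
      act X m \<phi> (classified X n (subcomplex n F) x m \<theta>)"
    using act_comp[OF \<phi> subcomplex_subset[OF \<theta>] assms]
    by (simp add: classified_apply[where S = "subcomplex n F", OF \<theta>] classified_apply[where S = "subcomplex n F", OF mcomp_subcomplex[OF \<theta> \<phi>]])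
qed (simp add: classified_def restrict_to_def)

lemma shom_eqI:
  assumes "f \<in> shom S X" "f' \<in> shom S X" "\<And>m \<theta>. \<theta> \<in> S m \<Longrightarrow> f m \<theta> = f' m \<theta>"
  shows "f = f'"
proof (intro ext)
  fix m \<theta>
  have "f m \<in> extensional (S m)" "f' m \<in> extensional (S m)"
    using assms(1,2) by (auto simp: shom_def PiE_def)
  then show "f m \<theta> = f' m \<theta>"
    using assms(3) by (cases "\<theta> \<in> S m") (auto simp: extensional_def)
qed


section \<open>Measurements on the nerve\<close>

lemma Z3_cases: "x = 0 \<or> x = 1 \<or> x = 2" for x :: 3
  using exhaust_3[of x] by auto

text \<open>The pairs \<open>(a, b)\<close> occurring in \<open>X\<^sub>2\<close> are the composable pairs of the effect algebra
  \<open>{0, 1/2, 1}\<close>, with \<open>2\<close> in the role of \<open>1/2\<close>.\<close>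

definition allowed :: "3 \<Rightarrow> 3 \<Rightarrow> bool" where
  "allowed a b \<longleftrightarrow> (a, b) \<notin> {(1, 1), (2, 1), (1, 2)}"

lemma allowed_rot: "allowed a b \<Longrightarrow> allowed (1 - a - b) a"
  using Z3_cases[of a] Z3_cases[of b] by (auto simp: allowed_def)

lemma allowed_0 [simp]: "allowed 0 b" "allowed a 0"
  by (auto simp: allowed_def)

text \<open>The nonzero pairs with sum 0 in Z/3 are \<open>(1, 2)\<close> and \<open>(2, 1)\<close>,
  both excluded: the inverses of the group are gone.\<close>

lemma allowed_sum_0: "allowed a b \<Longrightarrow> a + b = 0 \<Longrightarrow> a = 0 \<and> b = 0"
  using Z3_cases[of a] Z3_cases[of b] by (auto simp: allowed_def)

interpretation nerve: cyclic_set nerve_Z3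
  by (rule cyclic_set_nerve)

abbreviation (input) PN :: "(3 list \<Rightarrow> complex ^ 'h ^ 'h) cset" where
  "PN \<equiv> projective_measurements nerve_Z3"

interpretation PN: cyclic_set "PN :: (3 list \<Rightarrow> complex ^ 'h ^ 'h) cset"
  by (rule cyclic_set_projective_measurements[OF cyclic_set_nerve finite_simplices_nerve])

lemma simplices_PN: "P \<in> simplices PN n \<longleftrightarrow> pvm (simplices nerve_Z3 n) P"
  by (rule simplices_projective_measurements[OF finite_simplices_nerve])

lemmas act_PN = act_projective_measurements[of nerve_Z3]

lemma act_PN_commute:
  "P \<in> simplices PN n \<Longrightarrow> act PN n \<theta> P a ** act PN n \<phi> P b = act PN n \<phi> P b ** act PN n \<theta> P a"
  unfolding act_PN simplices_PN by (rule push_commute)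

lemma act_nerve_edge: "i \<le> j \<Longrightarrow> j \<le> n \<Longrightarrow> act nerve_Z3 n [i, j] x = [psum x j - psum x i]"
  by (simp add: act_nerve[of _ "Suc 0"])

lemma act_nerve_triangle:
  assumes "i \<le> j" "j \<le> k" "k \<le> n"
  shows "act nerve_Z3 n [i, j, k] x = [psum x j - psum x i, psum x k - psum x j]"
proof -
  have "[i, j, k] \<in> mono_maps 2 n"
    using assms by simp
  from act_nerve[OF this] show ?thesis
    by (simp add: numeral_2_eq_2)
qed

text \<open>The spine edges of a word are its entries, which separate words. This is spininess
  already for \<open>Y\<close>, and most equalities of simplices below rest on it.\<close>

lemma PN_eqI:
  assumes P: "P \<in> simplices PN n" and Q: "Q \<in> simplices PN n"
    and eq: "\<And>p. p < n \<Longrightarrow> act PN n [p, Suc p] P = act PN n [p, Suc p] Q"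
  shows "P = Q"
proof (rule pvm_eqI)
  show "pvm (simplices nerve_Z3 n) P" "pvm (simplices nerve_Z3 n) Q"
    using P Q by (simp_all add: simplices_PN)
  fix x y
  assume xy: "x \<in> simplices nerve_Z3 n" "y \<in> simplices nerve_Z3 n"
    and "\<And>p. p \<in> {..<n} \<Longrightarrow> act nerve_Z3 n [p, Suc p] x = act nerve_Z3 n [p, Suc p] y"
  then have "x ! p = y ! p" if "p < n" for p
    using that by (fastforce simp: act_nerve_edge psum_def)
  with xy show "x = y"
    by (auto simp: simplices_nerve intro: nth_equalityI)
next
  fix p
  assume "p \<in> {..<n}"
  then show "push (simplices nerve_Z3 n) (act nerve_Z3 n [p, Suc p]) P =
      push (simplices nerve_Z3 n) (act nerve_Z3 n [p, Suc p]) Q"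
    using eq[of p] by (simp add: act_PN)
qed

text \<open>A word is determined by all of its entries but the last, together with its sum.\<close>

lemma PN_commuteI:
  assumes Q: "Q \<in> simplices PN (Suc n)"
    and edges: "\<And>p a. p < n \<Longrightarrow>
      C ** act PN (Suc n) [p, Suc p] Q a = act PN (Suc n) [p, Suc p] Q a ** C"
    and total: "\<And>a. C ** act PN (Suc n) [0, Suc n] Q a = act PN (Suc n) [0, Suc n] Q a ** C"
  shows "C ** Q x = Q x ** C"
\<comment> \<open>Index \<open>n\<close> of the separating family stands for the total edge instead
  of the last edge, about which nothing is assumed.\<close>
proof (rule pvm_commuteI[where S = "{..n}"
      and f = "\<lambda>p. act nerve_Z3 (Suc n) (if p = n then [0, Suc n] else [p, Suc p])"])
  show "pvm (simplices nerve_Z3 (Suc n)) Q"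
    using Q by (simp add: simplices_PN)
  fix x y
  assume xy: "x \<in> simplices nerve_Z3 (Suc n)" "y \<in> simplices nerve_Z3 (Suc n)"
    and eq: "\<And>p. p \<in> {..n} \<Longrightarrow>
      act nerve_Z3 (Suc n) (if p = n then [0, Suc n] else [p, Suc p]) x =
      act nerve_Z3 (Suc n) (if p = n then [0, Suc n] else [p, Suc p]) y"
  have entries: "x ! p = y ! p" if "p < n" for p
    using eq[of p] that by (simp add: act_nerve_edge psum_def)
  show "x = y"
  proof (rule psum_eqI)
    fix j
    assume "j \<le> Suc n"
    show "psum x j = psum y j"
    proof (cases "j = Suc n")
      case True
      then show ?thesis
        using eq[of n] by (simp add: act_nerve_edge)
    next
      case False
      with \<open>j \<le> Suc n\<close> show ?thesis
        unfolding psum_def by (intro sum.cong) (auto simp: entries)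
    qed
  qed (use xy in \<open>simp_all add: simplices_nerve\<close>)
next
  fix p a
  assume "p \<in> {..n}"
  then show "C ** push (simplices nerve_Z3 (Suc n)) (act nerve_Z3 (Suc n)
        (if p = n then [0, Suc n] else [p, Suc p])) Q a =
      push (simplices nerve_Z3 (Suc n)) (act nerve_Z3 (Suc n)
        (if p = n then [0, Suc n] else [p, Suc p])) Q a ** C"
    using edges[of p a] total[of a] by (simp add: act_PN)
qed

text \<open>The product measurement on pairs is relabelled by prepending the single letter of an
  outcome of \<open>A\<close> to a word of \<open>Q\<close>; the two faces are then its
  marginals.\<close>

lemma PN_extend:
  assumes A: "A \<in> simplices PN 1" and Q: "Q \<in> simplices PN n"
    and comm: "\<And>x y. A x ** Q y = Q y ** A x"
  obtains R where "R \<in> simplices PN (Suc n)" "act PN (Suc n) [0, 1] R = A" "face PN (Suc n) 0 R = Q"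
proof -
  let ?I = "simplices nerve_Z3 1 \<times> simplices nerve_Z3 n"
  define AQ where "AQ = (\<lambda>(x, y). A x ** Q y)"
  define R where "R = push ?I (\<lambda>(x, y). hd x # y) AQ"
  note prod = pvm_product[OF A[unfolded simplices_PN] Q[unfolded simplices_PN] comm, folded AQ_def]
  have fin: "finite ?I"
    using prod(1) by (rule pvm_finite)
  have im: "(\<lambda>(x, y). hd x # y) ` ?I \<subseteq> simplices nerve_Z3 (Suc n)"
    by (auto simp: simplices_nerve)
  have R: "R \<in> simplices PN (Suc n)"
    unfolding R_def simplices_PN using prod(1) finite_simplices_nerve im by (rule pvm_push)
  have push_R: "push (simplices nerve_Z3 (Suc n)) f R = push ?I (\<lambda>z. f (case z of (x, y) \<Rightarrow> hd x # y)) AQ"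
    for f :: "3 list \<Rightarrow> 3 list"
    unfolding R_def by (rule push_push[OF fin finite_simplices_nerve im])
  have "act PN (Suc n) [0, 1] R = push ?I fst AQ"
    unfolding act_PN push_R
  proof (rule push_cong)
    fix z
    assume "z \<in> ?I"
    then obtain a y where "z = ([a], y)" "length y = n"
      by (auto simp: simplices_nerve length_Suc_conv)
    then show "act nerve_Z3 (Suc n) [0, 1] (case z of (x, y) \<Rightarrow> hd x # y) = fst z"
      by (simp add: act_nerve_edge psum_def)
  qed
  moreover have "face PN (Suc n) 0 R = push ?I snd AQ"
    unfolding face_def act_PN push_R
  proof (rule push_cong)
    fix z
    assume "z \<in> ?I"
    then obtain a y where "z = ([a], y)" "length y = n"
      by (auto simp: simplices_nerve length_Suc_conv)
    then show "act nerve_Z3 (Suc n) (coface (Suc n) 0) (case z of (x, y) \<Rightarrow> hd x # y) = snd z"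
      using nerve_Z3_face_0[of y a] by (simp add: face_def)
  qed
  ultimately show ?thesis
    using R prod(2,3) by (intro that) auto
qed

section \<open>The truncation\<close>

definition effect_trunc :: "nat \<Rightarrow> (3 list \<Rightarrow> complex ^ 'h ^ 'h) set" where
  "effect_trunc m = {P \<in> simplices PN m. m = 2 \<longrightarrow> P [1, 1] = 0 \<and> P [2, 1] = 0 \<and> P [1, 2] = 0}"

abbreviation (input) ZE :: "(3 list \<Rightarrow> complex ^ 'h ^ 'h) cset" where
  "ZE \<equiv> full_on_2_truncation PN effect_trunc"

text \<open>The condition defining \<open>Z\<close>, on single outcomes. Strict inequalities
  suffice, as a degenerate triangle carries a 0 and every pair with a 0 is allowed.\<close>

definition effect_word :: "nat \<Rightarrow> 3 list \<Rightarrow> bool" where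
  "effect_word n x \<longleftrightarrow>
     (\<forall>i j k. i < j \<longrightarrow> j < k \<longrightarrow> k \<le> n \<longrightarrow> allowed (psum x j - psum x i) (psum x k - psum x j))"

lemma effect_wordD:
  assumes "effect_word n x" "i \<le> j" "j \<le> k" "k \<le> n"
  shows "allowed (psum x j - psum x i) (psum x k - psum x j)"
proof (cases "i = j \<or> j = k")
  case False
  then show ?thesis
    using assms by (simp add: effect_word_def)
qed auto

lemma effect_trunc_2:
  "P \<in> effect_trunc 2 \<longleftrightarrow> P \<in> simplices PN 2 \<and> (\<forall>a b. \<not> allowed a b \<longrightarrow> P [a, b] = 0)"
  by (auto simp: effect_trunc_def allowed_def)

lemma mono_maps_2_cases:
  assumes "\<theta> \<in> mono_maps 2 n"
  obtains i j k where "\<theta> = [i, j, k]" "i \<le> j" "j \<le> k" "k \<le> n"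
  using assms by (auto simp: mono_maps_def length_Suc_conv numeral_2_eq_2)

text \<open>An entry of the face is the sum of the projectors over a fibre and vanishes only if each
  summand does.\<close>

lemma act_triangle_in_trunc:
  assumes P: "P \<in> simplices PN n" and ijk: "i \<le> j" "j \<le> k" "k \<le> n"
  shows "act PN n [i, j, k] P \<in> effect_trunc 2 \<longleftrightarrow>
    (\<forall>x. P x \<noteq> 0 \<longrightarrow> allowed (psum x j - psum x i) (psum x k - psum x j))"
proof -
  have P': "pvm (simplices nerve_Z3 n) P"
    using P by (simp add: simplices_PN)
  have zero: "act PN n [i, j, k] P y = 0 \<longleftrightarrow>
      (\<forall>x. psum x j - psum x i = a \<and> psum x k - psum x j = b \<longrightarrow> P x = 0)" if "y = [a, b]" for y a b
  proof
    assume "act PN n [i, j, k] P y = 0"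
    then have "P x = 0" if "x \<in> simplices nerve_Z3 n" "act nerve_Z3 n [i, j, k] x = y" for x
      unfolding act_PN push_def
      using orth_projector_sum_eq_0[of "{x. x \<in> simplices nerve_Z3 n \<and> act nerve_Z3 n [i, j, k] x = y}" P x]
        that pvm_orth_projector[OF P'] finite_simplices_nerve[of n] by simp
    then show "\<forall>x. psum x j - psum x i = a \<and> psum x k - psum x j = b \<longrightarrow> P x = 0"
      using pvm_outside[OF P'] that ijk by (metis act_nerve_triangle)
  next
    assume "\<forall>x. psum x j - psum x i = a \<and> psum x k - psum x j = b \<longrightarrow> P x = 0"
    then show "act PN n [i, j, k] P y = 0"
      unfolding act_PN using that ijk by (intro push_eq_0) (simp add: act_nerve_triangle)
  qed
  have "act PN n [i, j, k] P \<in> simplices PN 2"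
    using P ijk by (intro PN.act_closed) simp
  then show ?thesis
    unfolding effect_trunc_2 zero[OF refl] by auto
qed

text \<open>In degrees 0 and 1 the truncation is all of \<open>Y\<close>, and a degenerate triangle
  only has outcomes containing a 0, which are allowed.\<close>

lemma simplices_ZE:
  "P \<in> simplices ZE n \<longleftrightarrow> P \<in> simplices PN n \<and>
     (\<forall>i j k. i < j \<longrightarrow> j < k \<longrightarrow> k \<le> n \<longrightarrow> act PN n [i, j, k] P \<in> effect_trunc 2)"
  (is "?L \<longleftrightarrow> ?R")
proof
  assume ?L
  then show ?R
    by (simp add: simplices_full)
next
  assume R: ?R
  have "act PN n \<theta> P \<in> effect_trunc m" if "m \<le> 2" "\<theta> \<in> mono_maps m n" for m \<theta>
  proof (cases "m = 2")
    case True
    with that obtain i j k where \<theta>: "\<theta> = [i, j, k]" "i \<le> j" "j \<le> k" "k \<le> n"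
      using mono_maps_2_cases by metis
    have "act PN n [i, j, k] P \<in> effect_trunc 2"
    proof (cases "i < j \<and> j < k")
      case True
      then show ?thesis
        using R \<theta> by simp
    next
      case False
      then have "i = j \<or> j = k"
        using \<theta> by auto
      then show ?thesis
        using R \<theta> by (subst act_triangle_in_trunc) auto
    qed
    then show ?thesis
      by (simp add: \<theta>(1) True)
  next
    case False
    then show ?thesis
      using R PN.act_closed[OF that(2), of P] by (simp add: effect_trunc_def)
  qed
  then show ?L
    using R by (simp add: simplices_full)
qed

lemma simplices_ZE_support:
  "P \<in> simplices ZE n \<longleftrightarrow> P \<in> simplices PN n \<and> (\<forall>x. P x \<noteq> 0 \<longrightarrow> effect_word n x)"
proof -
  have "act PN n [i, j, k] P \<in> effect_trunc 2 \<longleftrightarrow>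
      (\<forall>x. P x \<noteq> 0 \<longrightarrow> allowed (psum x j - psum x i) (psum x k - psum x j))"
    if "P \<in> simplices PN n" "i < j" "j < k" "k \<le> n" for i j k
    using that by (intro act_triangle_in_trunc) auto
  then show ?thesis
    unfolding simplices_ZE effect_word_def by (metis (no_types, lifting))
qed

lemma ZE_subset: "P \<in> simplices ZE n \<Longrightarrow> P \<in> simplices PN n"
  by (simp add: simplices_full)

lemma ZE_2_subset_trunc:
  assumes "P \<in> simplices ZE 2"
  shows "P \<in> effect_trunc 2"
proof -
  have "act PN 2 [0..<Suc 2] P \<in> effect_trunc 2"
    using assms id_mono_maps[of 2] by (simp add: simplices_full del: upt_Suc)
  then show ?thesis
    using PN.act_id[OF ZE_subset[OF assms]] by (simp del: upt_Suc)
qed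

text \<open>With the third edge \<open>1 - a - b\<close> added, the allowed pairs become the cyclically ordered
  triples with entries \<open>1, 0, 0\<close> or \<open>2, 2, 0\<close>.\<close>

lemma effect_word_rot:
  assumes x: "length x = n" and ew: "effect_word n x"
  shows "effect_word n (rot nerve_Z3 n x)"
  unfolding effect_word_def
proof (intro allI impI)
  fix i j k :: nat
  assume ijk: "i < j" "j < k" "k \<le> n"
  show "allowed (psum (rot nerve_Z3 n x) j - psum (rot nerve_Z3 n x) i)
      (psum (rot nerve_Z3 n x) k - psum (rot nerve_Z3 n x) j)"
  \<comment> \<open>Vertex 0 after the rotation is vertex \<open>n\<close> before it, so
    \<open>(0, j, k)\<close> is the rotated triangle \<open>(j - 1, k - 1, n)\<close>; away from 0
    the indices merely shift.\<close>
  proof (cases "i = 0")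
    case True
    have "allowed (psum x (k - 1) - psum x (j - 1)) (psum x n - psum x (k - 1))"
      using ijk by (intro effect_wordD[OF ew]) auto
    from allowed_rot[OF this] show ?thesis
      using ijk True by (simp add: psum_rot_nerve[OF x] algebra_simps)
  next
    case False
    have "allowed (psum x (j - 1) - psum x (i - 1)) (psum x (k - 1) - psum x (j - 1))"
      using ijk by (intro effect_wordD[OF ew]) auto
    then show ?thesis
      using ijk False by (simp add: psum_rot_nerve[OF x] algebra_simps)
  qed
qed

section \<open>The cyclic, spiny and inverseless properties of \<open>Z\<close>\<close>

lemma cyclic_set_ZE: "cyclic_set (ZE :: (3 list \<Rightarrow> complex ^ 'h ^ 'h) cset)"
proof (rule cyclic_set_full)
  show "cyclic_set (PN :: (3 list \<Rightarrow> complex ^ 'h ^ 'h) cset)"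
    by (rule PN.cyclic_set_axioms)
  fix n and P :: "3 list \<Rightarrow> complex ^ 'h ^ 'h"
  assume P: "P \<in> simplices ZE n"
  have "effect_word n y" if nz: "rot PN n P y \<noteq> 0" for y
  proof -
    obtain x where x: "x \<in> simplices nerve_Z3 n" "rot nerve_Z3 n x = y" "P x \<noteq> 0"
      using push_nonzeroE[OF nz[unfolded rot_projective_measurements]] by metis
    then have "effect_word n x"
      using P by (simp add: simplices_ZE_support)
    with x effect_word_rot[of x n] show ?thesis
      by (simp add: simplices_nerve)
  qed
  moreover have "rot PN n P \<in> simplices PN n"
    using P by (intro PN.rot_closed ZE_subset)
  ultimately show "rot PN n P \<in> simplices ZE n"
    by (simp add: simplices_ZE_support)
qed

interpretation ZE: cyclic_set "ZE :: (3 list \<Rightarrow> complex ^ 'h ^ 'h) cset"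
  by (rule cyclic_set_ZE)

lemma spiny_ZE: "spiny ZE"
  unfolding spiny_def act_full
proof (intro allI impI inj_onI)
  fix n and P Q :: "3 list \<Rightarrow> complex ^ 'h ^ 'h"
  assume "P \<in> simplices ZE n" "Q \<in> simplices ZE n"
    and "map (\<lambda>i. act PN n [i, Suc i] P) [0..<n] = map (\<lambda>i. act PN n [i, Suc i] Q) [0..<n]"
  then show "P = Q"
    by (auto intro: PN_eqI[OF ZE_subset ZE_subset])
qed

lemma pvm_concentrated:
  assumes P: "pvm I P" and "x \<in> I" and "\<And>y. y \<noteq> x \<Longrightarrow> P y = 0"
  shows "P = (\<lambda>y. if y = x then mat 1 else 0)"
proof
  have "P x = (\<Sum>y\<in>I. P y)"
    using assms pvm_finite[OF P] by (subst sum.remove[of _ x]) (auto intro!: sum.neutral)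
  also have "\<dots> = mat 1"
    using P by (simp add: pvm_def)
  finally show "P y = (if y = x then mat 1 else 0)" for y
    using assms(3) by simp
qed

text \<open>A degenerate long edge makes \<open>a + b = 0\<close> certain, and \<open>(0, 0)\<close>
  is the only allowed pair with that sum; so the simplex is concentrated at
  \<open>[0, 0]\<close>.\<close>

lemma inverseless_ZE: "inverseless ZE"
proof -
  have d: "face ZE 2 1 (degen ZE 1 0 (degen ZE 0 0 x)) = degen ZE 0 0 x"
    if "x \<in> simplices ZE 0" for x :: "3 list \<Rightarrow> complex ^ 'h ^ 'h"
  proof -
    have m: "codegeneracy 0 0 \<in> mono_maps 1 0" "codegeneracy 1 0 \<in> mono_maps 2 1" "coface 2 1 \<in> mono_maps 1 2"
      using codegeneracy_mono_maps[of 0 0] codegeneracy_mono_maps[of 0 1] coface_mono_maps[of 2 1]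
      by (simp_all add: numeral_2_eq_2)
    have "mcomp (codegeneracy 0 0) (mcomp (codegeneracy 1 0) (coface 2 1)) = codegeneracy 0 0"
      by (simp add: codegeneracy_def coface_def mcomp_def numeral_2_eq_2)
    then show ?thesis
      unfolding face_def degen_def
      using ZE.act_comp[OF m(3,2) ZE.act_closed[OF m(1) that]]
        ZE.act_comp[OF mcomp_mono_maps[OF m(3,2)] m(1) that] by simp
  qed
  have dd: "degen ZE 1 0 (degen ZE 0 0 x) \<in> simplices ZE 2" if "x \<in> simplices ZE 0"
    for x :: "3 list \<Rightarrow> complex ^ 'h ^ 'h"
    using ZE.degen_closed[of 0 0 x] ZE.degen_closed[of 0 1 "degen ZE 0 0 x"] that
    by (simp add: numeral_2_eq_2)
  \<comment> \<open>The right side mentions neither \<open>\<sigma>\<close> nor \<open>x\<close>;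
    applied to a given simplex and to the double degeneracy, it identifies the two.\<close>
  have unique: "\<sigma> = (\<lambda>y. if y = [0, 0] then mat 1 else 0)"
    if \<sigma>: "\<sigma> \<in> simplices ZE 2" and x: "x \<in> simplices ZE 0" and eq: "face ZE 2 1 \<sigma> = degen ZE 0 0 x"
    for \<sigma> x :: "3 list \<Rightarrow> complex ^ 'h ^ 'h"
  proof (rule pvm_concentrated)
    show pvm: "pvm (simplices nerve_Z3 2) \<sigma>"
      using ZE_subset[OF \<sigma>] by (simp add: simplices_PN)
    show "[0, 0] \<in> simplices nerve_Z3 2"
      by (simp add: simplices_nerve)
    fix y :: "3 list"
    assume y: "y \<noteq> [0, 0]"
    show "\<sigma> y = 0"
    proof (rule ccontr)
      assume nz: "\<sigma> y \<noteq> 0"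
      then have "length y = 2"
        using pvm_outside[OF pvm] by (auto simp: simplices_nerve)
      then obtain a b where ab: "y = [a, b]"
        by (auto simp: length_Suc_conv numeral_2_eq_2)
      have all: "allowed a b"
        using ZE_2_subset_trunc[OF \<sigma>] nz ab by (auto simp: effect_trunc_2)
      have "coface 2 1 = [0, 2]" "codegeneracy 0 0 = [0, 0]"
        by (simp_all add: coface_def codegeneracy_def numeral_2_eq_2)
      with eq have eq': "push (simplices nerve_Z3 2) (act nerve_Z3 2 [0, 2]) \<sigma> =
          push (simplices nerve_Z3 0) (act nerve_Z3 0 [0, 0]) x"
        by (simp add: face_def degen_def act_full act_PN)
      have "push (simplices nerve_Z3 0) (act nerve_Z3 0 [0, 0]) x [a + b] = 0" if "a + b \<noteq> 0"
        using that by (intro push_eq_0) (simp add: act_nerve_edge)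
      \<comment> \<open>The outcome \<open>y\<close> lies over \<open>a + b\<close>, so this
        marginal fixes \<open>\<sigma> y\<close>; a zero marginal would kill it.\<close>
      moreover have "\<sigma> y ** push (simplices nerve_Z3 2) (act nerve_Z3 2 [0, 2]) \<sigma> [a + b] = \<sigma> y"
        using ab by (subst pvm_mult_push[OF pvm])
          (simp_all add: simplices_nerve act_nerve_edge psum_def numeral_2_eq_2)
      ultimately have "a + b = 0"
        using nz eq' by (cases "a + b = 0") auto
      then show False
        using allowed_sum_0[OF all] y ab by simp
    qed
  qed
  show ?thesis
    unfolding inverseless_def bij_betw_def
  proof (intro conjI inj_onI equalityI subsetI)
    fix z :: "(3 list \<Rightarrow> complex ^ 'h ^ 'h) \<times> (3 list \<Rightarrow> complex ^ 'h ^ 'h)"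
    assume "z \<in> (\<lambda>x. (degen ZE 1 0 (degen ZE 0 0 x), x)) ` simplices ZE 0"
    then show "z \<in> {(\<sigma>, x). \<sigma> \<in> simplices ZE 2 \<and> x \<in> simplices ZE 0 \<and> face ZE 2 1 \<sigma> = degen ZE 0 0 x}"
      using dd d by auto
  next
    fix z :: "(3 list \<Rightarrow> complex ^ 'h ^ 'h) \<times> (3 list \<Rightarrow> complex ^ 'h ^ 'h)"
    assume "z \<in> {(\<sigma>, x). \<sigma> \<in> simplices ZE 2 \<and> x \<in> simplices ZE 0 \<and> face ZE 2 1 \<sigma> = degen ZE 0 0 x}"
    then obtain \<sigma> x where z: "z = (\<sigma>, x)" and \<sigma>: "\<sigma> \<in> simplices ZE 2" and x: "x \<in> simplices ZE 0"
      and eq: "face ZE 2 1 \<sigma> = degen ZE 0 0 x"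
      by auto
    from unique[OF dd[OF x] x d[OF x]] unique[OF \<sigma> x eq] have "\<sigma> = degen ZE 1 0 (degen ZE 0 0 x)"
      by simp
    with z x show "z \<in> (\<lambda>x. (degen ZE 1 0 (degen ZE 0 0 x), x)) ` simplices ZE 0"
      by simp
  qed simp
qed


section \<open>The weak 2-Segal condition\<close>

lemma shom_ZE_edge:
  assumes f: "f \<in> shom (subcomplex n F) ZE" and \<theta>: "\<theta> \<in> subcomplex n F m" and "p \<le> q" "q \<le> m"
  shows "act PN m [p, q] (f m \<theta>) = f (Suc 0) [\<theta> ! p, \<theta> ! q]"
  using shom_mcomp[OF f \<theta>, of "[p, q]" "Suc 0"] assms(3,4) by (simp add: act_full)

lemma shom_ZE_PN:
  assumes "f \<in> shom (subcomplex n F) ZE" "\<theta> \<in> subcomplex n F m"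
  shows "f m \<theta> \<in> simplices PN m"
  using shom_closed[OF assms] by (rule ZE_subset)

text \<open>Simplices are determined by their spines, so maps are determined on edges; degenerate
  edges come from vertices, where \<open>Y\<close> has at most one simplex.\<close>

lemma shom_ZE_eqI:
  assumes f: "f \<in> shom (subcomplex n F) ZE" and f': "f' \<in> shom (subcomplex n F) ZE"
    and eq: "\<And>i j. [i, j] \<in> subcomplex n F (Suc 0) \<Longrightarrow> i < j \<Longrightarrow> f (Suc 0) [i, j] = f' (Suc 0) [i, j]"
  shows "f = f'"
proof (rule shom_eqI[OF f f'])
  fix m \<theta>
  assume \<theta>: "\<theta> \<in> subcomplex n F m"
  show "f m \<theta> = f' m \<theta>"
  proof (rule PN_eqI[OF shom_ZE_PN[OF f \<theta>] shom_ZE_PN[OF f' \<theta>]])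
    fix p
    assume "p < m"
    let ?i = "\<theta> ! p" and ?j = "\<theta> ! Suc p"
    have edge: "[?i, ?j] \<in> subcomplex n F (Suc 0)"
      using mcomp_subcomplex[OF \<theta>, of "[p, Suc p]" "Suc 0"] \<open>p < m\<close> by simp
    have "f (Suc 0) [?i, ?j] = f' (Suc 0) [?i, ?j]"
    proof (cases "?i < ?j")
      case True
      with edge show ?thesis
        by (rule eq)
    next
      case False
      have "?i \<le> ?j"
        using mono_maps_nth_mono[OF subcomplex_subset[OF \<theta>], of p "Suc p"] \<open>p < m\<close> by simp
      with False have j: "?j = ?i"
        by simp
      have v: "[?i] \<in> subcomplex n F 0"
        using mcomp_subcomplex[OF \<theta>, of "[p]" 0] \<open>p < m\<close> by (simp add: mcomp_def)
      have "f 0 [?i] = f' 0 [?i]"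
        by (rule PN_eqI[OF shom_ZE_PN[OF f v] shom_ZE_PN[OF f' v]]) simp
      then show ?thesis
        using shom_ZE_edge[OF f v, of 0 0] shom_ZE_edge[OF f' v, of 0 0] by (simp add: j)
    qed
    then show "act PN m [p, Suc p] (f m \<theta>) = act PN m [p, Suc p] (f' m \<theta>)"
      using shom_ZE_edge[OF f \<theta>, of p "Suc p"] shom_ZE_edge[OF f' \<theta>, of p "Suc p"] \<open>p < m\<close>
      by simp
  qed
qed

section \<open>Joint measurements on intervals\<close>

lemma PN_act_edge:
  assumes "\<theta> \<in> mono_maps m n" "P \<in> simplices PN n" "p \<le> q" "q \<le> m"
  shows "act PN m [p, q] (act PN n \<theta> P) = act PN n [\<theta> ! p, \<theta> ! q] P"
  using PN.act_comp[of "[p, q]" "Suc 0" m \<theta> n P] assms by simp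

lemma PN_face_0_edge:
  assumes "P \<in> simplices PN (Suc n)" "p \<le> q" "q \<le> n"
  shows "act PN n [p, q] (face PN (Suc n) 0 P) = act PN (Suc n) [Suc p, Suc q] P"
  using PN_act_edge[of "coface (Suc n) 0" n "Suc n" P p q] coface_mono_maps[of "Suc n" 0] assms
  by (simp add: face_def nth_coface)

text \<open>An interval is given by its start \<open>i\<close> and length \<open>m\<close>, so that
  \<open>P\<close> is an \<open>m\<close>-simplex with vertices counted from 0. By
  \<open>PN_eqI\<close> there is at most one such \<open>P\<close>.\<close>

definition joint :: "(nat \<Rightarrow> 3 list \<Rightarrow> complex ^ 'h ^ 'h) \<Rightarrow> nat \<Rightarrow> nat \<Rightarrow> (3 list \<Rightarrow> complex ^ 'h ^ 'h) \<Rightarrow> bool"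
  where "joint A i m P \<longleftrightarrow> P \<in> simplices PN m \<and> (\<forall>p<m. act PN m [p, Suc p] P = A (i + p))"

text \<open>The face of \<open>P\<close> on the block has the same spine as \<open>P'\<close>, hence
  equals it.\<close>

lemma joint_block:
  assumes P: "joint A i m P" and P': "joint A (i + a) m' P'" and "a + m' \<le> m" "p \<le> q" "q \<le> m'"
  shows "act PN m' [p, q] P' = act PN m [a + p, a + q] P"
proof -
  let ?b = "[a..<Suc (a + m')]"
  have b: "?b \<in> mono_maps m' m"
    using assms(3) by (intro mono_mapsI) (auto simp del: upt_Suc)
  have PN: "P \<in> simplices PN m" "P' \<in> simplices PN m'"
    using P P' by (simp_all add: joint_def)
  have edge: "act PN m' [p, q] (act PN m ?b P) = act PN m [a + p, a + q] P" if "p \<le> q" "q \<le> m'" for p q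
    using PN_act_edge[OF b PN(1) that] that by (simp del: upt_Suc)
  have "P' = act PN m ?b P"
    using PN(2) PN.act_closed[OF b PN(1)]
  proof (rule PN_eqI)
    fix p
    assume "p < m'"
    then show "act PN m' [p, Suc p] P' = act PN m' [p, Suc p] (act PN m ?b P)"
      using edge[of p "Suc p"] P P' assms(3) by (simp add: joint_def add.assoc del: upt_Suc)
  qed
  then show ?thesis
    using edge[OF assms(4,5)] by (simp del: upt_Suc)
qed

text \<open>The intervals overlap in all but their end edges. \<open>P\<close> makes
  \<open>A i\<close> commute with every edge of \<open>Q\<close> but the last, \<open>comm\<close>
  with the total; together these separate the outcomes of \<open>Q\<close>, so the product of
  \<open>A i\<close> and \<open>Q\<close> exists.\<close>

lemma joint_extend:
  assumes P: "joint A i (Suc m) P" and Q: "joint A (Suc i) (Suc m) Q"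
    and comm: "\<And>a b. A i a ** act PN (Suc m) [0, Suc m] Q b = act PN (Suc m) [0, Suc m] Q b ** A i a"
  obtains R where "joint A i (Suc (Suc m)) R"
proof -
  have PN: "P \<in> simplices PN (Suc m)" "Q \<in> simplices PN (Suc m)"
    using P Q by (simp_all add: joint_def)
  have A: "A i = act PN (Suc m) [0, 1] P"
    using P by (auto simp: joint_def)
  have "A i a ** Q x = Q x ** A i a" for a x
  proof (rule PN_commuteI[OF PN(2)])
    fix p b
    assume "p < m"
    then have "act PN (Suc m) [p, Suc p] Q = act PN (Suc m) [Suc p, Suc (Suc p)] P"
      using P Q by (simp add: joint_def)
    then show "A i a ** act PN (Suc m) [p, Suc p] Q b = act PN (Suc m) [p, Suc p] Q b ** A i a"
      unfolding A by (simp add: act_PN_commute[OF PN(1)])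
  qed (rule comm)
  moreover have "A i \<in> simplices PN 1"
    unfolding A using PN(1) by (intro PN.act_closed) simp_all
  ultimately obtain R where R: "R \<in> simplices PN (Suc (Suc m))" "act PN (Suc (Suc m)) [0, 1] R = A i"
    "face PN (Suc (Suc m)) 0 R = Q"
    using PN(2) by (metis PN_extend)
  have "act PN (Suc (Suc m)) [p, Suc p] R = A (i + p)" if "p < Suc (Suc m)" for p
  proof (cases p)
    case 0
    then show ?thesis
      using R(2) by simp
  next
    case (Suc r)
    then show ?thesis
      using PN_face_0_edge[OF R(1), of r "Suc r"] R(3) Q that by (simp add: joint_def)
  qed
  with R(1) show ?thesis
    by (intro that[of R]) (simp add: joint_def)
qed

lemma lim_shom_PiE: "g \<in> lim_shom P X \<Longrightarrow> g \<in> (\<Pi>\<^sub>E S\<in>P. shom S X)"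
  unfolding lim_shom_def by blast

lemma lim_shom_restrict:
  "g \<in> lim_shom P X \<Longrightarrow> S \<in> P \<Longrightarrow> S' \<in> P \<Longrightarrow> S \<le> S' \<Longrightarrow> g S = restrict_to S (g S')"
  unfolding lim_shom_def by blast

section \<open>Compatible families over the triangulations\<close>

locale segal_cocone =
  fixes n :: nat and g :: "(nat \<Rightarrow> nat list set) \<Rightarrow> nat \<Rightarrow> nat list \<Rightarrow> 3 list \<Rightarrow> complex ^ 'h ^ 'h"
  assumes n: "3 \<le> n" and g: "g \<in> lim_shom (segal_poset n) ZE"
begin

abbreviation "edges T \<equiv> T \<union> polygon_sides n"

abbreviation gT where "gT T \<equiv> g (triangulated n T)"

definition A where "A i = g (spine n) (Suc 0) [i, Suc i]"

lemma g_shom: "S \<in> segal_poset n \<Longrightarrow> g S \<in> shom S ZE"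
  using lim_shom_PiE[OF g] by (rule PiE_mem)

lemma spine_in_segal_poset: "spine n \<in> segal_poset n"
  by (simp add: segal_poset_def)

lemma triangulated_in_segal_poset: "triangulation n T \<Longrightarrow> triangulated n T \<in> segal_poset n"
  by (auto simp: segal_poset_def)

lemma gT_shom: "triangulation n T \<Longrightarrow> gT T \<in> shom (subcomplex n (triangles n T)) ZE"
  using g_shom[OF triangulated_in_segal_poset] by (simp add: triangulated_def)

text \<open>The inclusion of the spine ties all triangulations to one sequence \<open>A\<close>;
  their values on diagonals are not yet comparable.\<close>

lemma g_spine_edge:
  assumes "triangulation n T" "i < n"
  shows "gT T (Suc 0) [i, Suc i] = A i"
proof -
  have le: "spine n \<le> triangulated n T"
    using spine_le_triangulated[OF assms(1)] n by simp
  have "g (spine n) = restrict_to (spine n) (gT T)"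
    by (rule lim_shom_restrict[OF g spine_in_segal_poset triangulated_in_segal_poset[OF assms(1)] le])
  then show ?thesis
    using spine_edge[OF assms(2)] by (simp add: A_def restrict_to_def)
qed

lemma A_in_PN: "i < n \<Longrightarrow> A i \<in> simplices PN (Suc 0)"
  unfolding A_def by (rule ZE_subset[OF shom_closed[OF g_shom[OF spine_in_segal_poset] spine_edge]])

lemma gT_triangle:
  assumes T: "triangulation n T" and ijk: "i < j" "j < k" "k \<le> n"
    and e: "{(i, j), (j, k), (i, k)} \<subseteq> edges T"
  defines "s \<equiv> gT T 2 [i, j, k]"
  shows "s \<in> simplices ZE 2" "act PN 2 [0, 1] s = gT T (Suc 0) [i, j]"
    "act PN 2 [1, 2] s = gT T (Suc 0) [j, k]" "act PN 2 [0, 2] s = gT T (Suc 0) [i, k]"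
proof -
  have t: "[i, j, k] \<in> subcomplex n (triangles n T) 2"
    using triangulated_triangle[OF e ijk] by (simp add: triangulated_def)
  show "s \<in> simplices ZE 2"
    unfolding s_def by (rule shom_closed[OF gT_shom[OF T] t])
  show "act PN 2 [0, 1] s = gT T (Suc 0) [i, j]"
    "act PN 2 [1, 2] s = gT T (Suc 0) [j, k]" "act PN 2 [0, 2] s = gT T (Suc 0) [i, k]"
    unfolding s_def
    using shom_ZE_edge[OF gT_shom[OF T] t, of 0 1] shom_ZE_edge[OF gT_shom[OF T] t, of 1 2]
      shom_ZE_edge[OF gT_shom[OF T] t, of 0 2] by simp_all
qed

text \<open>A triangle is determined by its two short edges, so agreement with \<open>R\<close> on
  these passes to the long edge.\<close>

lemma gT_triangle_eq:
  assumes T: "triangulation n T" and ijk: "i < j" "j < k" "k \<le> n"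
    and e: "{(i, j), (j, k), (i, k)} \<subseteq> edges T"
    and R: "R \<in> simplices PN m" "a \<le> b" "b \<le> c" "c \<le> m"
    and eq: "gT T (Suc 0) [i, j] = act PN m [a, b] R" "gT T (Suc 0) [j, k] = act PN m [b, c] R"
  shows "gT T 2 [i, j, k] = act PN m [a, b, c] R" "gT T (Suc 0) [i, k] = act PN m [a, c] R"
proof -
  let ?s = "gT T 2 [i, j, k]"
  note tri = gT_triangle[OF T ijk e]
  have t: "[a, b, c] \<in> mono_maps 2 m"
    using R by simp
  note edge = PN_act_edge[OF t R(1)]
  show s: "?s = act PN m [a, b, c] R"
    using ZE_subset[OF tri(1)] PN.act_closed[OF t R(1)]
  proof (rule PN_eqI)
    fix p :: nat
    assume "p < 2"
    then consider "p = 0" | "p = 1"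
      by linarith
    then show "act PN 2 [p, Suc p] ?s = act PN 2 [p, Suc p] (act PN m [a, b, c] R)"
      by cases (use tri edge[of 0 1] edge[of 1 2] eq in \<open>simp_all add: numeral_2_eq_2\<close>)
  qed
  show "gT T (Suc 0) [i, k] = act PN m [a, c] R"
    using tri(4) edge[of 0 2] by (simp add: s)
qed

text \<open>The measurement \<open>A i\<close> commutes with \<open>A (i + 1), \<dots>, A (i + m - 2)\<close> inside the joint
  measurement on \<open>[i, i + m - 1]\<close>, and with their sum up to \<open>A (i + m - 1)\<close> inside the triangle
  \<open>{i, i + 1, i + m}\<close> of some triangulation.\<close>

lemma joint_exists:
  assumes "1 \<le> m" "i + m \<le> n"
  shows "\<exists>P. joint A i m P \<and> (\<forall>T. triangulation n T \<longrightarrow> (i, i + m) \<in> edges T \<longrightarrow>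
    gT T (Suc 0) [i, i + m] = act PN m [0, m] P)"
  using assms
\<comment> \<open>Shorter intervals at varying positions are used: the first clause supplies
  \<open>P\<close> and \<open>Q\<close>, the second identifies totals with diagonals.\<close>
proof (induction m arbitrary: i rule: less_induct)
  case (less m)
  show ?case
  proof (cases "m = 1")
    case True
    have A: "A i \<in> simplices PN (Suc 0)"
      using less.prems True by (intro A_in_PN) simp
    have "act PN (Suc 0) [0, Suc 0] (A i) = A i"
      using PN.act_id[OF A] by simp
    then show ?thesis
      using A True less.prems by (intro exI[of _ "A i"]) (auto simp: joint_def g_spine_edge)
  next
    case False
    define r where "r = m - 2"
    have m: "m = Suc (Suc r)"
      using False less.prems by (simp add: r_def)
    have im: "Suc i + Suc r = i + m"
      using m by simp
    have i: "i < Suc i" "Suc i < i + m" "i + m \<le> n"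
      using m less.prems by auto
    have "\<exists>P. joint A i (Suc r) P \<and> (\<forall>T. triangulation n T \<longrightarrow> (i, i + Suc r) \<in> edges T \<longrightarrow>
        gT T (Suc 0) [i, i + Suc r] = act PN (Suc r) [0, Suc r] P)"
      by (rule less.IH) (use i m in linarith)+
    then obtain P where P: "joint A i (Suc r) P"
      by blast
    have "\<exists>P. joint A (Suc i) (Suc r) P \<and> (\<forall>T. triangulation n T \<longrightarrow> (Suc i, i + m) \<in> edges T \<longrightarrow>
        gT T (Suc 0) [Suc i, i + m] = act PN (Suc r) [0, Suc r] P)"
      by (rule less.IH[of "Suc r" "Suc i", unfolded im]) (use i m in linarith)+
    then obtain Q where Q: "joint A (Suc i) (Suc r) Q"
      and gQ: "\<And>T. triangulation n T \<Longrightarrow> (Suc i, i + m) \<in> edges T \<Longrightarrow>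
        gT T (Suc 0) [Suc i, i + m] = act PN (Suc r) [0, Suc r] Q"
      by blast
    obtain T0 where T0: "triangulation n T0"
      "{(i, Suc i), (Suc i, i + m), (i, i + m)} \<subseteq> edges T0"
      using triangle_in_triangulation[OF i] .
    have "A i a ** act PN (Suc r) [0, Suc r] Q b = act PN (Suc r) [0, Suc r] Q b ** A i a" for a b
    proof -
      note tri = gT_triangle[OF T0(1) _ _ _ T0(2)]
      have "A i = act PN 2 [0, 1] (gT T0 2 [i, Suc i, i + m])"
        using tri(2)[OF i] g_spine_edge[OF T0(1), of i] i by simp
      moreover have "act PN (Suc r) [0, Suc r] Q = act PN 2 [1, 2] (gT T0 2 [i, Suc i, i + m])"
        using tri(3)[OF i] gQ[OF T0(1)] T0(2) by simp
      ultimately show ?thesis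
        by (simp add: act_PN_commute[OF ZE_subset[OF tri(1)[OF i]]])
    qed
    then obtain R where R: "joint A i m R"
      using joint_extend[OF P Q] m by metis
    \<comment> \<open>In an arbitrary \<open>T\<close> the triangle below \<open>(i, i + m)\<close>
      has an apex \<open>k\<close>; by induction both shorter edges are marginals of
      \<open>R\<close>, hence so is the long one.\<close>
    have "gT T (Suc 0) [i, i + m] = act PN m [0, m] R"
      if T: "triangulation n T" and e: "(i, i + m) \<in> edges T" for T
    proof -
      have "i + 2 \<le> i + m"
        using m by simp
      then obtain k where k: "i < k" "k < i + m" "(i, k) \<in> edges T" "(k, i + m) \<in> edges T"
        using triangulation_inner_vertex[OF T e] by metis
      define c where "c = k - i"
      have c: "0 < c" "c < m" and im: "k + (m - c) = i + m" and ik: "i + c = k"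
        using k(1,2) by (auto simp: c_def)
      have "\<exists>P. joint A i c P \<and> (\<forall>T. triangulation n T \<longrightarrow> (i, k) \<in> edges T \<longrightarrow>
          gT T (Suc 0) [i, k] = act PN c [0, c] P)"
        by (rule less.IH[of c i, unfolded ik]) (use c i k in linarith)+
      then obtain P1 where P1: "joint A i c P1" and g1: "gT T (Suc 0) [i, k] = act PN c [0, c] P1"
        using T k(3) by blast
      have "\<exists>P. joint A k (m - c) P \<and> (\<forall>T. triangulation n T \<longrightarrow> (k, i + m) \<in> edges T \<longrightarrow>
          gT T (Suc 0) [k, i + m] = act PN (m - c) [0, m - c] P)"
        by (rule less.IH[of "m - c" k, unfolded im]) (use c i in linarith)+
      then obtain P2 where P2: "joint A k (m - c) P2"
        and g2: "gT T (Suc 0) [k, i + m] = act PN (m - c) [0, m - c] P2"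
        using T k(4) by blast
      have e1: "gT T (Suc 0) [i, k] = act PN m [0, c] R"
        using joint_block[OF R, of 0 c P1 0 c] P1 g1 c by simp
      have e2: "gT T (Suc 0) [k, i + m] = act PN m [c, m] R"
        using joint_block[OF R P2[folded ik], of 0 "m - c"] g2 c by simp
      have R_PN: "R \<in> simplices PN m"
        using R by (simp add: joint_def)
      have tri: "{(i, k), (k, i + m), (i, i + m)} \<subseteq> edges T"
        using k e by simp
      show ?thesis
        by (rule gT_triangle_eq(2)[OF T k(1,2) i(3) tri R_PN _ _ _ e1 e2]) (use c in linarith)+
    qed
    with R show ?thesis
      by auto
  qed
qed

text \<open>The candidate is the joint measurement of the whole spine; it has the right edges in
  every triangulation, and edges determine maps.\<close>

lemma cone_point:
  obtains R where "R \<in> simplices ZE n"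
    "\<And>S. S \<in> segal_poset n \<Longrightarrow> g S = classified ZE n S R"
proof -
  obtain R where R: "joint A 0 n R"
    using joint_exists[of n 0] n by auto
  then have R_PN: "R \<in> simplices PN n"
    by (simp add: joint_def)
  have edge: "gT T (Suc 0) [i, j] = act PN n [i, j] R"
    if T: "triangulation n T" and e: "(i, j) \<in> edges T" for T i j
  proof -
    have ij: "i < j" "j \<le> n"
      using triangulation_edge_bounds[OF T _ e] n by auto
    have j: "i + (j - i) = j"
      using ij by simp
    have "\<exists>P. joint A i (j - i) P \<and> (\<forall>T. triangulation n T \<longrightarrow> (i, j) \<in> edges T \<longrightarrow>
        gT T (Suc 0) [i, j] = act PN (j - i) [0, j - i] P)"
      by (rule joint_exists[of "j - i" i, unfolded j]) (use ij in linarith)+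
    then obtain P where P: "joint A i (j - i) P" "gT T (Suc 0) [i, j] = act PN (j - i) [0, j - i] P"
      using T e by blast
    then show ?thesis
      using joint_block[OF R, of i "j - i" P 0 "j - i"] ij by simp
  qed
  \<comment> \<open>Each triple is a triangle of some triangulation, and the value of the family
    there already lies in the truncation; different triples may call for different
    triangulations.\<close>
  have R_ZE: "R \<in> simplices ZE n"
    unfolding simplices_ZE
  proof (intro conjI allI impI R_PN)
    fix i j k
    assume ijk: "i < j" "j < k" "k \<le> n"
    obtain T where T: "triangulation n T" "{(i, j), (j, k), (i, k)} \<subseteq> edges T"
      using triangle_in_triangulation[OF ijk] .
    have "gT T 2 [i, j, k] = act PN n [i, j, k] R"
      by (rule gT_triangle_eq(1)[OF T(1) ijk T(2) R_PN])
        (use T ijk edge[OF T(1)] in auto)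
    then show "act PN n [i, j, k] R \<in> effect_trunc 2"
      using ZE_2_subset_trunc[OF gT_triangle(1)[OF T(1) ijk T(2)]] by simp
  qed
  have "g S = classified ZE n S R" if S: "S \<in> segal_poset n" for S
    using S
  proof (cases rule: segal_poset_cases)
    case 1
    show ?thesis
      unfolding 1 spine_def
    proof (rule shom_ZE_eqI)
      show "g (subcomplex n {{i, Suc i} |i. i < n}) \<in> shom (subcomplex n {{i, Suc i} |i. i < n}) ZE"
        using g_shom[OF S] by (simp add: 1 spine_def)
      show "classified ZE n (subcomplex n {{i, Suc i} |i. i < n}) R
          \<in> shom (subcomplex n {{i, Suc i} |i. i < n}) ZE"
        using R_ZE by (rule ZE.classified_shom)
      fix i j
      assume ij: "[i, j] \<in> subcomplex n {{i, Suc i} |i. i < n} (Suc 0)" "i < j"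
      then have "j = Suc i" "i < n"
        by (auto simp: subcomplex_def)
      then show "g (subcomplex n {{i, Suc i} |i. i < n}) (Suc 0) [i, j] =
          classified ZE n (subcomplex n {{i, Suc i} |i. i < n}) R (Suc 0) [i, j]"
        using R ij by (simp add: classified_apply act_full joint_def A_def spine_def)
    qed
  next
    case (2 T)
    show ?thesis
      unfolding 2 triangulated_def
    proof (rule shom_ZE_eqI)
      show "g (subcomplex n (triangles n T)) \<in> shom (subcomplex n (triangles n T)) ZE"
        using gT_shom[OF 2(1)] by (simp add: triangulated_def)
      show "classified ZE n (subcomplex n (triangles n T)) R \<in> shom (subcomplex n (triangles n T)) ZE"
        using R_ZE by (rule ZE.classified_shom)
      fix i j
      assume ij: "[i, j] \<in> subcomplex n (triangles n T) (Suc 0)" "i < j"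
      then have "(i, j) \<in> edges T"
        by (intro triangulated_edgeD) (simp_all add: triangulated_def)
      then show "g (subcomplex n (triangles n T)) (Suc 0) [i, j] =
          classified ZE n (subcomplex n (triangles n T)) R (Suc 0) [i, j]"
        using edge[OF 2(1)] ij by (simp add: classified_apply act_full triangulated_def)
    qed
  qed
  with R_ZE show ?thesis
    by (rule that)
qed

end

lemma weakly_two_Segal_ZE: "weakly_two_Segal (ZE :: (3 list \<Rightarrow> complex ^ 'h ^ 'h) cset)"
  unfolding weakly_two_Segal_def
proof (intro allI impI bij_betw_imageI inj_onI)
  fix n :: nat and P Q :: "3 list \<Rightarrow> complex ^ 'h ^ 'h"
  assume P: "P \<in> simplices ZE n" and Q: "Q \<in> simplices ZE n"
    and eq: "(\<lambda>S\<in>segal_poset n. classified ZE n S P) = (\<lambda>S\<in>segal_poset n. classified ZE n S Q)"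
  have "spine n \<in> segal_poset n"
    by (simp add: segal_poset_def)
  with fun_cong[OF eq, of "spine n"] have spine: "classified ZE n (spine n) P = classified ZE n (spine n) Q"
    by simp
  show "P = Q"
    using ZE_subset[OF P] ZE_subset[OF Q]
  proof (rule PN_eqI)
    fix p
    assume "p < n"
    from spine_edge[OF this] show "act PN n [p, Suc p] P = act PN n [p, Suc p] Q"
      using fun_cong[OF fun_cong[OF spine, of "Suc 0"], of "[p, Suc p]"]
      by (simp add: classified_apply act_full)
  qed
next
  fix n :: nat
  assume n: "3 \<le> n"
  show "(\<lambda>P. \<lambda>S\<in>segal_poset n. classified ZE n S P) ` simplices (ZE :: (3 list \<Rightarrow> complex ^ 'h ^ 'h) cset) n =
      lim_shom (segal_poset n) ZE"
  proof (intro equalityI subsetI)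
    fix g :: "(nat \<Rightarrow> nat list set) \<Rightarrow> nat \<Rightarrow> nat list \<Rightarrow> 3 list \<Rightarrow> complex ^ 'h ^ 'h"
    assume "g \<in> (\<lambda>P. \<lambda>S\<in>segal_poset n. classified ZE n S P) ` simplices ZE n"
    then obtain P where P: "P \<in> simplices ZE n" and g: "g = (\<lambda>S\<in>segal_poset n. classified ZE n S P)"
      by auto
    have "classified ZE n S P \<in> shom S ZE" if "S \<in> segal_poset n" for S
      using segal_poset_subcomplex[OF that] ZE.classified_shom[OF P] by auto
    then show "g \<in> lim_shom (segal_poset n) ZE"
      unfolding lim_shom_def g by (simp add: restrict_to_classified)
  next
    fix g :: "(nat \<Rightarrow> nat list set) \<Rightarrow> nat \<Rightarrow> nat list \<Rightarrow> 3 list \<Rightarrow> complex ^ 'h ^ 'h"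
    assume g: "g \<in> lim_shom (segal_poset n) ZE"
    interpret segal_cocone n g
      using n g by unfold_locales
    obtain R where R: "R \<in> simplices ZE n" "\<And>S. S \<in> segal_poset n \<Longrightarrow> g S = classified ZE n S R"
      using cone_point by metis
    have "g = (\<lambda>S\<in>segal_poset n. classified ZE n S R)"
    proof
      fix S
      have "g \<in> extensional (segal_poset n)"
        using lim_shom_PiE[OF g] by (simp add: PiE_def)
      then show "g S = (\<lambda>S\<in>segal_poset n. classified ZE n S R) S"
        using R(2) by (simp add: extensional_def)
    qed
    then show "g \<in> (\<lambda>P. \<lambda>S\<in>segal_poset n. classified ZE n S P) ` simplices ZE n"
      using R(1) by (rule image_eqI)
  qed
qed


section \<open>Failure of the 2-Segal condition\<close>

text \<open>Pushing forward from booleans allows \<open>u = v\<close>, where both outcomes merge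
  into a certain one. Structure maps act on the labels only, which is how the shared edge of the
  counterexample forgets \<open>P\<close>.\<close>

definition binary_pvm :: "complex ^ 'h ^ 'h \<Rightarrow> 'i \<Rightarrow> 'i \<Rightarrow> 'i \<Rightarrow> complex ^ 'h ^ 'h" where
  "binary_pvm P u v = push UNIV (\<lambda>b. if b then u else v) (\<lambda>b. if b then P else mat 1 - P)"

lemma pvm_binary:
  assumes "orth_projector P" "finite I" "u \<in> I" "v \<in> I"
  shows "pvm I (binary_pvm P u v)"
  unfolding binary_pvm_def
proof (rule pvm_push)
  show "pvm UNIV (\<lambda>b. if b then P else mat 1 - P)"
    using assms(1) by (simp add: pvm_def UNIV_bool orth_projector_compl)
qed (use assms in auto)

lemma push_binary:
  assumes "finite I" "u \<in> I" "v \<in> I"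
  shows "push I f (binary_pvm P u v) = binary_pvm P (f u) (f v)"
  unfolding binary_pvm_def using assms
  by (subst push_push) (auto intro!: arg_cong[where f = "\<lambda>f. push UNIV f _"])

lemma binary_pvm_same: "binary_pvm P u u y = (if y = u then mat 1 else 0)"
  by (auto simp: binary_pvm_def push_def UNIV_bool)

lemma binary_pvm_fst: "u \<noteq> v \<Longrightarrow> binary_pvm P u v u = P"
  using push_inj[of "\<lambda>b. if b then u else v" UNIV True "\<lambda>b. if b then P else mat 1 - P"]
  by (simp add: binary_pvm_def inj_on_def)

lemma binary_pvm_outside: "y \<noteq> u \<Longrightarrow> y \<noteq> v \<Longrightarrow> binary_pvm P u v y = 0"
  unfolding binary_pvm_def by (rule push_eq_0) (auto split: if_splits)

text \<open>The projector onto the line spanned by the indicator vector of \<open>S\<close>.\<close>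

definition indicator_projector :: "'h set \<Rightarrow> complex ^ 'h ^ 'h" where
  "indicator_projector S = (\<chi> r c. if r \<in> S \<and> c \<in> S then 1 / of_nat (card S) else 0)"

text \<open>In an entry of the square the sum has \<open>card S\<close> equal nonzero terms, which
  cancels one of the two factors \<open>1 / card S\<close>.\<close>

lemma orth_projector_indicator:
  fixes S :: "'h::finite set"
  shows "orth_projector (indicator_projector S)"
  unfolding orth_projector_def
proof
  have "(indicator_projector S ** indicator_projector S) $ r $ c = indicator_projector S $ r $ c" for r c
  proof -
    have "(indicator_projector S ** indicator_projector S) $ r $ c =
        (\<Sum>k\<in>UNIV. if k \<in> S then (if r \<in> S \<and> c \<in> S then 1 / (of_nat (card S) * of_nat (card S)) else 0) else 0)"
      unfolding matrix_matrix_mult_def indicator_projector_def by (auto intro!: sum.cong)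
    also have "\<dots> = of_nat (card S) * (if r \<in> S \<and> c \<in> S then 1 / (of_nat (card S) * of_nat (card S)) else 0)"
      by (simp flip: sum.inter_restrict)
    also have "\<dots> = indicator_projector S $ r $ c"
      by (simp add: indicator_projector_def)
    finally show ?thesis .
  qed
  then show "indicator_projector S ** indicator_projector S = indicator_projector S"
    by (simp add: vec_eq_iff)
  show "adjoint_mat (indicator_projector S) = indicator_projector S"
    by (auto simp: adjoint_mat_def map_matrix_def transpose_def indicator_projector_def vec_eq_iff)
qed

text \<open>The entry \<open>(i, j)\<close> tells the products apart: projecting to the
  \<open>i\<close>-th basis vector on the left keeps row \<open>i\<close>, with entry 1/2, while on
  the right it erases column \<open>j\<close>.\<close>

lemma indicator_projector_not_commute:
  assumes "i \<noteq> j"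
  shows "indicator_projector {i} ** indicator_projector {i, j} \<noteq>
    indicator_projector {i, j} ** indicator_projector {i}"
proof
  assume "indicator_projector {i} ** indicator_projector {i, j} =
    indicator_projector {i, j} ** indicator_projector {i}"
  then have "(indicator_projector {i} ** indicator_projector {i, j}) $ i $ j =
      (indicator_projector {i, j} ** indicator_projector {i}) $ i $ j"
    by simp
  moreover have "(indicator_projector {i} ** indicator_projector {i, j}) $ i $ j =
      (\<Sum>k\<in>UNIV. if k = i then 1 / 2 else 0)"
    unfolding matrix_matrix_mult_def indicator_projector_def vec_lambda_beta
    by (rule sum.cong) (use assms in auto)
  moreover have "(indicator_projector {i, j} ** indicator_projector {i}) $ i $ j = 0"
    unfolding matrix_matrix_mult_def indicator_projector_def
    using assms by (auto intro!: sum.neutral)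
  ultimately show False
    by simp
qed

section \<open>The square and a map on its triangulation without filler\<close>

lemma polygon_3: "polygon_sides 3 = {(0, 1), (1, 2), (2, 3), (0, 3)}"
  "polygon_diagonals 3 = {(0, 2), (1, 3)}"
proof -
  have "polygon_sides 3 = (\<lambda>i. (i, Suc i)) ` {..<3} \<union> {(0, 3)}"
    unfolding polygon_sides_def by blast
  also have "{..<3} = {0, 1, 2 :: nat}"
    by auto
  finally show sides: "polygon_sides 3 = {(0, 1), (1, 2), (2, 3), (0, 3)}"
    by (simp add: insert_commute numeral_2_eq_2 numeral_3_eq_3)
  show "polygon_diagonals 3 = {(0, 2), (1, 3)}"
  proof (intro equalityI subrelI)
    fix i j :: nat
    assume "(i, j) \<in> polygon_diagonals 3"
    then have ij: "i < j" "j \<le> 3" and "(i, j) \<notin> polygon_sides 3"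
      by (simp_all add: polygon_diagonals_def)
    moreover have "i = 0 \<or> i = 1 \<or> i = 2" "j = 1 \<or> j = 2 \<or> j = 3"
      using ij by linarith+
    ultimately show "(i, j) \<in> {(0, 2), (1, 3)}"
      unfolding sides by (elim disjE) simp_all
  qed (simp add: polygon_diagonals_def sides, elim disjE, simp_all)
qed

lemma triangulation_square: "triangulation 3 {(0, 2)}"
  by (simp add: triangulation_def polygon_3 crossing_def insert_Diff_if)

lemma triangles_square: "triangles 3 {(0, 2)} = {{0, 1, 2}, {0, 2, 3}}"
proof -
  have e: "{(0, 2)} \<union> polygon_sides 3 = {(0, 1), (1, 2), (2, 3), (0, 3), (0, 2)}"
    by (auto simp: polygon_3)
  have "A = {0, 1, 2} \<or> A = {0, 2, 3}" if tri: "A \<in> triangles 3 {(0, 2)}" for A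
  proof -
    obtain i j k :: nat where A: "A = {i, j, k}" and ijk: "i < j" "j < k" "k \<le> 3"
      and edge: "{(i, j), (j, k), (i, k)} \<subseteq> {(0, 1), (1, 2), (2, 3), (0, 3), (0, 2)}"
      using tri unfolding triangles_def mem_Collect_eq e by iprover
    have "i = 0 \<or> i = 1" "j = 1 \<or> j = 2" "k = 2 \<or> k = 3"
      using ijk by linarith+
    then show ?thesis
      using ijk edge unfolding A by (elim disjE) simp_all
  qed
  moreover have "{0, 1, 2} \<in> triangles 3 {(0, 2)}" "{0, 2, 3} \<in> triangles 3 {(0, 2)}"
    by (rule trianglesI; simp add: polygon_3)+
  ultimately show ?thesis
    by (intro equalityI subsetI) auto
qed

lemma act_PN_binary:
  assumes "length u = n" "length v = n"
  shows "act PN n \<theta> (binary_pvm P u v) = binary_pvm P (act nerve_Z3 n \<theta> u) (act nerve_Z3 n \<theta> v)"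
  unfolding act_PN using assms by (intro push_binary) (simp_all add: simplices_nerve finite_simplices_nerve)

lemma effect_word_3I:
  assumes "allowed a b" "allowed a (b + c)" "allowed (a + b) c" "allowed b c"
  shows "effect_word 3 [a, b, c]"
  unfolding effect_word_def
proof (intro allI impI)
  fix i j k :: nat
  assume "i < j" "j < k" "k \<le> 3"
  then have "i = 0 \<and> j = 1 \<and> k = 2 \<or> i = 0 \<and> j = 1 \<and> k = 3 \<or>
      i = 0 \<and> j = 2 \<and> k = 3 \<or> i = 1 \<and> j = 2 \<and> k = 3"
    by presburger
  then show "allowed (psum [a, b, c] j - psum [a, b, c] i) (psum [a, b, c] k - psum [a, b, c] j)"
    using assms by (elim disjE) (simp_all add: psum_def numeral_2_eq_2 numeral_3_eq_3 algebra_simps)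
qed

lemma binary_in_ZE:
  assumes "orth_projector P" "length u = n" "length v = n" "effect_word n u" "effect_word n v"
  shows "binary_pvm P u v \<in> simplices ZE n"
proof -
  have "binary_pvm P u v \<in> simplices PN n"
    using assms(1-3)
    by (simp add: simplices_PN pvm_binary finite_simplices_nerve simplices_nerve)
  moreover have "effect_word n x" if "binary_pvm P u v x \<noteq> 0" for x
    using binary_pvm_outside[of x u v P] that assms(4,5) by blast
  ultimately show ?thesis
    by (simp add: simplices_ZE_support)
qed

text \<open>On the triangle \<open>{0, 1, 2}\<close> the outcomes are \<open>(2, 0)\<close> and \<open>(0, 2)\<close>, so the edge \<open>{0, 2}\<close>
  carries the certain outcome \<open>2\<close> and does not constrain the measurement on \<open>{2, 3}\<close>.\<close>

lemma not_two_Segal_ZE: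
  fixes P R :: "complex ^ 'h ^ 'h"
  assumes P: "orth_projector P" and R: "orth_projector R" and PR: "P ** R \<noteq> R ** P"
  shows "\<not> two_Segal (ZE :: (3 list \<Rightarrow> complex ^ 'h ^ 'h) cset)"
proof
  assume Segal: "two_Segal (ZE :: (3 list \<Rightarrow> complex ^ 'h ^ 'h) cset)"
  let ?F = "{{0, 1, 2}, {0, 2, 3}} :: nat set set"
  \<comment> \<open>\<open>p\<close> serves the triangle \<open>{0, 1, 2}\<close> and
    \<open>r\<close> the triangle \<open>{0, 2, 3}\<close>: \<open>P\<close> sits at outcome 2 of
    the edge \<open>{0, 1}\<close>, \<open>R\<close> at outcome 2 of \<open>{2, 3}\<close>. The
    remaining entries make both 3-simplices of \<open>Z\<close> with certain outcome 2 on
    \<open>{0, 2}\<close>.\<close>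
  define p where "p = binary_pvm P [2, 0, 0] [0, 2, 0 :: 3]"
  define r where "r = binary_pvm R [2, 0, 2] [2, 0, 0 :: 3]"
  have pZ: "p \<in> simplices ZE 3" and rZ: "r \<in> simplices ZE 3"
    unfolding p_def r_def
    by (intro binary_in_ZE effect_word_3I P R; simp add: allowed_def)+
  note pr = ZE_subset[OF pZ] ZE_subset[OF rZ]
  have edge: "act PN 3 [a, b] p = act PN 3 [a, b] r" if "a \<in> {0, 2}" "b \<in> {0, 2}" "a \<le> b" for a b
    unfolding p_def r_def using that
    by (auto simp: act_PN_binary act_nerve_edge psum_def numeral_2_eq_2 binary_pvm_same fun_eq_iff)
  \<comment> \<open>A simplex lying in both triangles has its vertices in \<open>{0, 2}\<close>, so
    its edges are among those just compared.\<close>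
  have agree: "act PN 3 \<theta> p = act PN 3 \<theta> r"
    if \<theta>: "\<theta> \<in> mono_maps m 3" "set \<theta> \<subseteq> {0, 1, 2}" "set \<theta> \<subseteq> {0, 2, 3}" for m \<theta>
    using PN.act_closed[OF \<theta>(1) pr(1)] PN.act_closed[OF \<theta>(1) pr(2)]
  proof (rule PN_eqI)
    fix q
    assume q: "q < m"
    have "v \<in> {0, 2}" if "v \<in> set \<theta>" for v
      using subsetD[OF \<theta>(2) that] subsetD[OF \<theta>(3) that] by auto
    then have "\<theta> ! q \<in> {0, 2}" "\<theta> ! Suc q \<in> {0, 2}"
      using q mono_maps_length[OF \<theta>(1)] by simp_all
    from edge[OF this] show "act PN m [q, Suc q] (act PN 3 \<theta> p) = act PN m [q, Suc q] (act PN 3 \<theta> r)"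
      using q mono_maps_nth_mono[OF \<theta>(1), of q "Suc q"] by (simp add: PN_act_edge[OF \<theta>(1)] pr)
  qed
  \<comment> \<open>By \<open>agree\<close> either branch may be used on the overlap, so the gluing
    is a simplicial map.\<close>
  define f where "f = (\<lambda>m. \<lambda>\<theta>\<in>subcomplex 3 ?F m.
    if set \<theta> \<subseteq> {0, 1, 2} then act PN 3 \<theta> p else act PN 3 \<theta> r)"
  have f_r: "f m \<theta> = act PN 3 \<theta> r" if "\<theta> \<in> mono_maps m 3" "set \<theta> \<subseteq> {0, 2, 3}" for m \<theta>
    using that agree[OF that(1) _ that(2)] by (auto simp: f_def subcomplex_def)
  have f_p: "f m \<theta> = act PN 3 \<theta> p" if "\<theta> \<in> mono_maps m 3" "set \<theta> \<subseteq> {0, 1, 2}" for m \<theta>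
    using that by (auto simp: f_def subcomplex_def)
  have f_cases: "\<exists>x\<in>{p, r}. f m \<theta> = act PN 3 \<theta> x \<and> f k (mcomp \<theta> \<phi>) = act PN 3 (mcomp \<theta> \<phi>) x"
    if "\<theta> \<in> subcomplex 3 ?F m" "\<phi> \<in> mono_maps k m" for k m \<theta> \<phi>
  proof -
    have \<theta>: "\<theta> \<in> mono_maps m 3" "set \<theta> \<subseteq> {0, 1, 2} \<or> set \<theta> \<subseteq> {0, 2, 3}"
      using that(1) by (auto simp: subcomplex_def)
    have sub: "set (mcomp \<theta> \<phi>) \<subseteq> set \<theta>" "mcomp \<theta> \<phi> \<in> mono_maps k 3"
      using set_mcomp_subset[OF that(2) \<theta>(1)] mcomp_mono_maps[OF that(2) \<theta>(1)] .
    show ?thesis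
      using \<theta>(2)
    proof
      assume s: "set \<theta> \<subseteq> {0, 1, 2}"
      show ?thesis
        using f_p[OF \<theta>(1) s] f_p[OF sub(2) subset_trans[OF sub(1) s]] by simp
    next
      assume s: "set \<theta> \<subseteq> {0, 2, 3}"
      show ?thesis
        using f_r[OF \<theta>(1) s] f_r[OF sub(2) subset_trans[OF sub(1) s]] by simp
    qed
  qed
  have "f \<in> shom (subcomplex 3 ?F) ZE"
    unfolding shom_def
  proof (safe intro!: PiE_I)
    fix m \<theta>
    assume \<theta>: "\<theta> \<in> subcomplex 3 ?F m"
    note \<theta>' = subcomplex_subset[OF \<theta>]
    show "f m \<theta> \<in> simplices ZE m"
      using ZE.act_closed[OF \<theta>' pZ] ZE.act_closed[OF \<theta>' rZ] \<theta> by (simp add: f_def act_full)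
    fix k \<phi>
    assume \<phi>: "\<phi> \<in> mono_maps k m"
    show "f k (mcomp \<theta> \<phi>) = act ZE m \<phi> (f m \<theta>)"
      using f_cases[OF \<theta> \<phi>] PN.act_comp[OF \<phi> \<theta>' pr(1)] PN.act_comp[OF \<phi> \<theta>' pr(2)]
      by (auto simp: act_full)
  qed (simp add: f_def)
  moreover have "bij_betw (classified ZE 3 (subcomplex 3 ?F))
      (simplices (ZE :: (3 list \<Rightarrow> complex ^ 'h ^ 'h) cset) 3) (shom (subcomplex 3 ?F) ZE)"
    using Segal[unfolded two_Segal_def, rule_format, OF order_refl triangulation_square]
    unfolding triangulated_def triangles_square .
  ultimately have "f \<in> classified ZE 3 (subcomplex 3 ?F) ` simplices ZE 3"
    using bij_betw_imp_surj_on by blast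
  then obtain x where x: "x \<in> simplices ZE 3" "f = classified ZE 3 (subcomplex 3 ?F) x"
    by (rule imageE)
  \<comment> \<open>A filler would be a single measurement with \<open>P\<close> and
    \<open>R\<close> among the entries of its marginals, and these all commute.\<close>
  have "act PN 3 [0, 1] x = f (Suc 0) [0, 1]" "act PN 3 [2, 3] x = f (Suc 0) [2, 3]"
    unfolding x(2) by (simp_all add: classified_apply act_full subcomplex_def)
  moreover have "f (Suc 0) [0, 1] = act PN 3 [0, 1] p" "f (Suc 0) [2, 3] = act PN 3 [2, 3] r"
    by (intro f_p f_r; simp)+
  moreover have "act PN 3 [0, 1] p [2] = P" "act PN 3 [2, 3] r [2] = R"
    by (simp_all add: p_def r_def act_PN_binary act_nerve_edge psum_def binary_pvm_fst
        numeral_2_eq_2 numeral_3_eq_3)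
  ultimately have "P ** R = R ** P"
    using act_PN_commute[OF ZE_subset[OF x(1)], of "[0, 1]" "[2]" "[2, 3]" "[2]"] by simp
  with PR show False ..
qed

theorem proposition6p12:
  fixes Y Z :: "(3 list \<Rightarrow> complex ^ (3 \<times> 3) ^ (3 \<times> 3)) cset"
    and X :: "nat \<Rightarrow> (3 list \<Rightarrow> complex ^ (3 \<times> 3) ^ (3 \<times> 3)) set"
  assumes "Y = projective_measurements nerve_Z3"
    and "X 0 = simplices Y 0"
    and "X 1 = simplices Y 1"
    and "X 2 = {P \<in> simplices Y 2. P [1, 1] = 0 \<and> P [2, 1] = 0 \<and> P [1, 2] = 0}"
    and "Z = full_on_2_truncation Y X"
  shows "simplicial_effect Z \<and> \<not> effect_algebroid Z"
proof -
  \<comment> \<open>The hypotheses fix \<open>X\<close> in degrees up to 2, the range inspected by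
    \<open>full_on_2_truncation\<close>.\<close>
  have "X m = effect_trunc m" if "m \<le> 2" for m
  proof -
    from that consider "m = 0" | "m = 1" | "m = 2"
      by linarith
    then show ?thesis
      by cases (use assms(1-4) in \<open>simp_all add: effect_trunc_def\<close>)
  qed
  then have Z: "Z = ZE"
    unfolding assms(1,5) full_on_2_truncation_def by (simp cong: conj_cong)
  \<comment> \<open>Two distinct basis vectors: the projectors onto one of them and onto the line of
    their sum do not commute.\<close>
  let ?i = "(0, 0) :: 3 \<times> 3" and ?j = "(0, 1) :: 3 \<times> 3"
  have "\<not> two_Segal Z"
    unfolding Z
    by (rule not_two_Segal_ZE[OF orth_projector_indicator orth_projector_indicator
          indicator_projector_not_commute[of ?i ?j]]) simp
  then show ?thesis
    unfolding simplicial_effect_def effect_algebroid_def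
    by (simp add: Z cyclic_set_ZE spiny_ZE inverseless_ZE weakly_two_Segal_ZE)
qed

end
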